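(* Let $A\in SL(3,\mathbb{Z})$ be an integer matrix with three distinct positive real eigenvalues $0<\lambda_1<1<\lambda_2<\lambda_3$, and let $f_A:\mathbb{T}^3\to\mathbb{T}^3$ be the induced toral automorphism. Let $E^u_A\subset\mathbb{R}^3$ denote the eigenline of $A$ for the eigenvalue $\lambda_3$. Then there exists a $C^1$ neighborhood $\mathcal{U}$ of $f_A$ such that for every $f\in\mathcal{U}$ the following holds: if $f$ is accessible, then for every lift $F:\mathbb{R}^3\to\mathbb{R}^3$ of $f$, every $R>0$ and all $x,y\in\mathbb{R}^3$, $$\mathcal{F}^u_F(y)\not\subset B_R(x+E^u_A).$$
   Context: $\mathbb{T}^3=\mathbb{R}^3/\mathbb{Z}^3$ with quotient map $\pi:\mathbb{R}^3\to\mathbb{T}^3$; a lift of $f$ is a map $F:\mathbb{R}^3\to\mathbb{R}^3$ with $\pi\circ F=f\circ\pi$. A diffeomorphism $f$ of a compact Riemannian manifold $M$ is partially hyperbolic if there is a $Tf$-invariant splitting $TM=E^s\oplus E^c\oplus E^u$ and constants $C\ge1$, $0<\lambda<\hat\gamma<1<\gamma<\mu$ such that for all $x\in M$, $n\ge0$: $|Tf^nv|\le C\lambda^n|v|$ for $v\in E^s(x)$; $C^{-1}\hat\gamma^n|v|\le|Tf^nv|\le C\gamma^n|v|$ for $v\in E^c(x)$; $C^{-1}\mu^n|v|\le|Tf^nv|$ for $v\in E^u(x)$. Here all three bundles are one-dimensional. For $f_A$ this splitting is given by the eigenlines of $\lambda_1,\lambda_2,\lambda_3$ respectively, and every $f$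 $C^1$-close to $f_A$ is partially hyperbolic with one-dimensional bundles. $\mathcal{F}^u_f$ is the strong unstable foliation of $f$ (the unique foliation tangent to $E^u_f$), and $\mathcal{F}^u_F$ is its lift to $\mathbb{R}^3$. $f$ is accessible if any two points of $\mathbb{T}^3$ can be joined by a piecewise smooth path each of whose pieces lies in a single strong stable or strong unstable leaf of $f$. For $S\subset\mathbb{R}^3$, $B_R(S)=\{p\in\mathbb{R}^3: d(p,q)\le R\text{ for some }q\in S\}$. *)

theory Defs
  imports "HOL-Analysis.Analysis"
begin

text \<open>The torus T^3 = R^3/Z^3 is modelled by the fundamental domain [0,1)^3;
  the quotient map sends x to its componentwise fractional part.\<close>

definition lat :: "(real^3) set" where
  "lat = {k. \<forall>i. k $ i \<in> \<int>}"

definition tpi :: "real^3 \<Rightarrow> real^3" where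
  "tpi x = (\<chi> i. frac (x $ i))"

definition is_lift :: "(real^3 \<Rightarrow> real^3) \<Rightarrow> (real^3 \<Rightarrow> real^3) \<Rightarrow> bool" where
  "is_lift f F \<longleftrightarrow> continuous_on UNIV F \<and> (\<forall>x. tpi (F x) = f (tpi x))"

definition dF :: "(real^3 \<Rightarrow> real^3) \<Rightarrow> real^3 \<Rightarrow> real^3 \<Rightarrow> real^3" where
  "dF F x = frechet_derivative F (at x)"

definition C1_map :: "(real^3 \<Rightarrow> real^3) \<Rightarrow> bool" where
  "C1_map F \<longleftrightarrow> (\<forall>x. F differentiable (at x)) \<and>
     (\<forall>v. continuous_on UNIV (\<lambda>x. dF F x v))"

definition C1_diffeo :: "(real^3 \<Rightarrow> real^3) \<Rightarrow> bool" where
  "C1_diffeo F \<longleftrightarrow> bij F \<and> C1_map F \<and> C1_map (inv F)"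

definition torus_C1_diffeo :: "(real^3 \<Rightarrow> real^3) \<Rightarrow> bool" where
  "torus_C1_diffeo f \<longleftrightarrow> (\<exists>F. is_lift f F \<and> C1_diffeo F)"

definition fA :: "real^3^3 \<Rightarrow> real^3 \<Rightarrow> real^3" where
  "fA A x = tpi (A *v x)"

definition C1_close :: "real \<Rightarrow> real^3^3 \<Rightarrow> (real^3 \<Rightarrow> real^3) \<Rightarrow> bool" where
  "C1_close eps A f \<longleftrightarrow> (\<exists>F. is_lift f F \<and> C1_map F \<and>
      (\<forall>x. norm (F x - A *v x) < eps) \<and>
      (\<forall>x. onorm (\<lambda>v. dF F x v - A *v v) < eps))"

definition SL3Z :: "real^3^3 \<Rightarrow> bool" where
  "SL3Z A \<longleftrightarrow> (\<forall>i j. A $ i $ j \<in> \<int>) \<and> det A = 1"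

definition is_eigenvalue :: "real^3^3 \<Rightarrow> real \<Rightarrow> bool" where
  "is_eigenvalue A l \<longleftrightarrow> (\<exists>v. v \<noteq> 0 \<and> A *v v = l *\<^sub>R v)"

definition eigenline :: "real^3^3 \<Rightarrow> real \<Rightarrow> (real^3) set" where
  "eigenline A l = {v. A *v v = l *\<^sub>R v}"

definition closed_nbhd :: "real \<Rightarrow> (real^3) set \<Rightarrow> (real^3) set" where
  "closed_nbhd R S = {p. \<exists>q\<in>S. dist p q \<le> R}"

definition ph_splitting :: "(real^3 \<Rightarrow> real^3) \<Rightarrow> (real^3 \<Rightarrow> (real^3) set) \<Rightarrow>
    (real^3 \<Rightarrow> (real^3) set) \<Rightarrow> (real^3 \<Rightarrow> (real^3) set) \<Rightarrow> bool" where
  "ph_splitting F Es Ec Eu \<longleftrightarrow>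
     (\<forall>x. \<forall>E\<in>{Es, Ec, Eu}. subspace (E x) \<and> dim (E x) = 1 \<and>
           (\<forall>k\<in>lat. E (x + k) = E x) \<and> dF F x ` E x = E (F x)) \<and>
     (\<forall>x. {a + b + c | a b c. a \<in> Es x \<and> b \<in> Ec x \<and> c \<in> Eu x} = UNIV) \<and>
     (\<exists>C lam gh g mu. C \<ge> 1 \<and> 0 < lam \<and> lam < gh \<and> gh < 1 \<and> 1 < g \<and> g < mu \<and>
        (\<forall>x n. (\<forall>v\<in>Es x. norm (dF (F ^^ n) x v) \<le> C * lam ^ n * norm v) \<and>
               (\<forall>v\<in>Ec x. inverse C * gh ^ n * norm v \<le> norm (dF (F ^^ n) x v) \<and>
                          norm (dF (F ^^ n) x v) \<le> C * g ^ n * norm v) \<and>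
               (\<forall>v\<in>Eu x. inverse C * mu ^ n * norm v \<le> norm (dF (F ^^ n) x v))))"

definition leaf :: "(real^3 \<Rightarrow> (real^3) set) \<Rightarrow> real^3 \<Rightarrow> (real^3) set" where
  "leaf E y = {z. \<exists>\<gamma> \<gamma>'. \<gamma> 0 = y \<and> \<gamma> 1 = z \<and> continuous_on {0..1} \<gamma>' \<and>
      (\<forall>t\<in>{0..1::real}. (\<gamma> has_vector_derivative \<gamma>' t) (at t within {0..1}) \<and>
                         \<gamma>' t \<in> E (\<gamma> t))}"

text \<open>su-paths in R^3; f is accessible iff any two points of T^3 are joined by an su-path,
  i.e. for all lifted points p, q some integer translate of q is su-reachable from p.\<close>
definition su_step :: "(real^3 \<Rightarrow> (real^3) set) \<Rightarrow> (real^3 \<Rightarrow> (real^3) set) \<Rightarrow>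
    real^3 \<Rightarrow> real^3 \<Rightarrow> bool" where
  "su_step Es Eu p q \<longleftrightarrow> q \<in> leaf Es p \<or> q \<in> leaf Eu p"

definition accessible :: "(real^3 \<Rightarrow> (real^3) set) \<Rightarrow> (real^3 \<Rightarrow> (real^3) set) \<Rightarrow> bool" where
  "accessible Es Eu \<longleftrightarrow> (\<forall>p q. \<exists>k\<in>lat. (su_step Es Eu)\<^sup>*\<^sup>* p (q + k))"

end

theory Submission
  imports Defs "HOL-Analysis.Kronecker_Approximation_Theorem"
begin

text \<open>The center coordinate \<open>\<phi>(p) = lim w(F\<^sup>n p) / \<lambda>\<^sub>2\<^sup>n\<close>, where \<open>w\<close> is the left eigenvector of \<open>A\<close> for
  \<open>\<lambda>\<^sub>2\<close>, is continuous, at bounded distance from \<open>w\<close>, satisfies \<open>\<phi>(F p) = \<lambda>\<^sub>2 \<phi>(p)\<close> and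
  \<open>\<phi>(p + k) = \<phi>(p) + w(k)\<close> for integer vectors \<open>k\<close>. It is constant on strong stable leaves because
  these are contracted. If one strong unstable leaf stays near a line parallel to \<open>E\<^sup>u\<^sub>A\<close>, then \<open>\<phi>\<close>
  is bounded on it; iterating backwards divides its oscillation by \<open>\<lambda>\<^sub>2\<close>, so a limit leaf has constant
  \<open>\<phi>\<close>. The conjugacy with \<open>A\<close> maps that leaf to a line parallel to \<open>E\<^sup>u\<^sub>A\<close>, which is dense in the
  torus, and by continuity \<open>\<phi>\<close> is constant on all strong unstable leaves. Hence every su-path stays
  in a level set of \<open>\<phi>\<close>, and under accessibility \<open>\<phi>\<close> would take only countably many values.

  Strong unstable leaves are handled without invariant manifold theory: \<open>F - A\<close> is globally
  \<open>\<delta>\<close>-Lipschitz, so a leaf is the set of points whose backward iterates all differ from those of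
  the base point by a vector in a fixed cone.\<close>

subsection \<open>Derivatives of iterates\<close>

text \<open>In eigencoordinates the triple (\<open>sig\<close>, \<open>phi\<close>,
  \<open>psi\<close>) is the conjugacy of \<open>F\<close> with \<open>A\<close>. A conjugacy
  respects stable leaves, which are characterized by forward convergence. It need not send strong
  unstable leaves to parallels of the eigenline: the center expands as well, so convergence in the
  past does not single out the strong direction. Hence \<open>phi\<close> may vary along strong
  unstable leaves, and this is the freedom that a leaf near a line takes away. The bundles are given
  with unspecified constants, without continuity and without unique integrability. The proof
  therefore takes cone and rates from \<open>A\<close>, forces the unstable bundle into this cone,
  and gets continuity of the bundle and its integral curves from the gap \<open>al < be\<close>.
  Both inclusions between leaves and cone-defined sets matter: one bounds \<open>phi\<close> on the
  whole set, the other keeps every tangent curve inside it.\<close>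

lemma funpow_differentiable:
  fixes P :: "real^3 \<Rightarrow> real^3"
  assumes "\<And>x. P differentiable (at x)"
  shows "(P ^^ n) differentiable (at x)"
proof (induction n arbitrary: x)
  case 0
  then show ?case by (simp add: id_def)
next
  case (Suc n)
  have "(P \<circ> (P ^^ n)) differentiable (at x)"
    by (rule differentiable_chain_at) (use Suc assms in auto)
  then show ?case by (simp add: o_def)
qed

lemma has_derivative_dF:
  assumes "P differentiable (at x)"
  shows "(P has_derivative dF P x) (at x)"
  using assms by (simp add: dF_def frechet_derivative_works)

lemma dF_eqI:
  assumes "(P has_derivative D) (at x)"
  shows "dF P x = D"
  using assms frechet_derivative_at unfolding dF_def by fastforce

lemma dF_funpow_Suc:
  assumes "\<And>x. P differentiable (at x)"
  shows "dF (P ^^ Suc n) x v = dF P ((P ^^ n) x) (dF (P ^^ n) x v)"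
proof -
  have "((P \<circ> (P ^^ n)) has_derivative (dF P ((P ^^ n) x) \<circ> dF (P ^^ n) x)) (at x)"
    by (rule diff_chain_at) (use assms funpow_differentiable has_derivative_dF in blast)+
  from dF_eqI[OF this] show ?thesis by simp
qed

lemma dF_funpow_0: "dF (P ^^ 0) x v = v"
proof -
  have "dF (\<lambda>x. x) x = (\<lambda>x. x)"
    by (rule dF_eqI) (rule has_derivative_ident)
  then show ?thesis by (simp add: id_def)
qed

lemma linear_dF:
  assumes "P differentiable (at x)"
  shows "linear (dF P x)"
  using has_derivative_dF[OF assms] has_derivative_linear by blast

subsection \<open>Invariant cones\<close>

text \<open>The \<open>a1\<close>, \<open>a2\<close>, \<open>a3\<close> are left eigenvectors, so
  \<open>A\<close> acts on each coordinate of \<open>N\<close> separately. \<open>F\<close> stands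
  for a lift and \<open>G\<close> for its inverse. The inequalities \<open>ls\<close> keep the three
  rates and 1 apart up to an error \<delta>; \<open>B\<close> may be large, since a lift can be
  shifted by any integer vector.\<close>

locale near_linear =
  fixes A :: "real^3^3" and a1 a2 a3 v3 :: "real^3" and l1 l2 l3 \<delta> c B :: real
    and F G :: "real^3 \<Rightarrow> real^3" and N :: "real^3 \<Rightarrow> real"
  assumes eigen: "\<And>x. a1 \<bullet> (A *v x) = l1 * (a1 \<bullet> x)"
      "\<And>x. a2 \<bullet> (A *v x) = l2 * (a2 \<bullet> x)" "\<And>x. a3 \<bullet> (A *v x) = l3 * (a3 \<bullet> x)"
    and v3: "a1 \<bullet> v3 = 0" "a2 \<bullet> v3 = 0" "a3 \<bullet> v3 = 1"
    and N_def: "\<And>x. N x = max \<bar>a1 \<bullet> x\<bar> (max \<bar>a2 \<bullet> x\<bar> \<bar>a3 \<bullet> x\<bar>)"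
    and c: "c > 0" "\<And>x. norm x \<le> c * N x" "\<And>x. N x \<le> c * norm x"
    and ls: "0 < l1" "0 < \<delta>" "l1 + \<delta> < 1" "1 < l2 - \<delta>" "l2 + \<delta> < l3 - \<delta>"
    and FG [simp]: "\<And>x. F (G x) = x" "\<And>x. G (F x) = x"
    and F_diff: "\<And>x. F differentiable (at x)"
    and G_diff: "\<And>x. G differentiable (at x)"
    and G_C1: "\<And>v. continuous_on UNIV (\<lambda>x. dF G x v)"
    and F_close: "\<And>x y. N (F x - F y - A *v (x - y)) \<le> \<delta> * N (x - y)"
    and dF_close: "\<And>x v. N (dF F x v - A *v v) \<le> \<delta> * N v"
    and F_bounded: "\<And>x. N (F x - A *v x) \<le> B"
    and F_lat: "\<And>x k. k \<in> lat \<Longrightarrow> F (x + k) = F x + A *v k"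
    and A_in_lat: "\<And>k. k \<in> lat \<Longrightarrow> A *v k \<in> lat"
    and A_lat: "\<And>k. k \<in> lat \<Longrightarrow> \<exists>j\<in>lat. A *v j = k"
    and dense: "\<And>x e. e > 0 \<Longrightarrow> \<exists>t. \<exists>k\<in>lat. norm (x - t *\<^sub>R v3 - k) < e"
begin

text \<open>\<open>step\<close> covers both finite differences and tangent vectors of \<open>F\<close>. A step expands
  vectors of the cone \<open>K\<close> around \<open>v3\<close> by at least \<open>be\<close>, and vectors that are still
  outside of it by at most \<open>al\<close>.\<close>

definition al where "al = l2 + \<delta>"
definition be where "be = l3 - \<delta>"
definition m where "m x = max \<bar>a1 \<bullet> x\<bar> \<bar>a2 \<bullet> x\<bar>"
definition K where "K = {x. m x \<le> \<bar>a3 \<bullet> x\<bar>}"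
definition step where "step a b \<longleftrightarrow> N (b - A *v a) \<le> \<delta> * N a"

lemma al_be: "1 < al" "al < be" "0 < al" "0 < be" "1 < be"
  using ls by (auto simp: al_def be_def)

lemma N_cone: "x \<in> K \<Longrightarrow> N x = \<bar>a3 \<bullet> x\<bar>"
  by (auto simp: K_def m_def N_def)

lemma N_not_cone: "x \<notin> K \<Longrightarrow> N x = m x"
  unfolding K_def m_def N_def by (simp add: max.assoc[symmetric] max.absorb1 del: max_less_iff_conj max.bounded_iff)

lemma N_0 [simp]: "N 0 = 0" by (simp add: N_def)

lemma N_nonneg [simp]: "N x \<ge> 0" by (simp add: N_def)

lemma m_nonneg [simp]: "m x \<ge> 0" by (simp add: m_def)

lemma coord_le_N: "\<bar>a1 \<bullet> x\<bar> \<le> N x" "\<bar>a2 \<bullet> x\<bar> \<le> N x" "\<bar>a3 \<bullet> x\<bar> \<le> N x"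
  by (auto simp: N_def)

lemma N_eq_0: "N x = 0 \<longleftrightarrow> x = 0"
  using c(2)[of x] by auto

lemma N_minus: "N (- x) = N x" by (simp add: N_def)

lemma N_triangle: "N (x + y) \<le> N x + N y"
proof -
  have "\<bar>a \<bullet> (x + y)\<bar> \<le> \<bar>a \<bullet> x\<bar> + \<bar>a \<bullet> y\<bar>" for a
    by (simp add: inner_add_right)
  then have "\<bar>a1 \<bullet> (x + y)\<bar> \<le> N x + N y" "\<bar>a2 \<bullet> (x + y)\<bar> \<le> N x + N y"
      "\<bar>a3 \<bullet> (x + y)\<bar> \<le> N x + N y"
    using coord_le_N by (meson add_mono order_trans)+
  then show ?thesis using N_def[of "x + y"] by simp
qed

lemma N_triangle_diff: "N (x - y) \<le> N x + N y"
  using N_triangle[of x "- y"] by (simp add: N_minus)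

lemma N_scaleR: "N (r *\<^sub>R x) = \<bar>r\<bar> * N x"
  by (simp add: N_def abs_mult max_mult_distrib_left)

lemma K_scaleR: "x \<in> K \<Longrightarrow> r *\<^sub>R x \<in> K"
  by (auto simp: K_def m_def abs_mult mult_left_mono)

lemma K_minus: "- x \<in> K \<longleftrightarrow> x \<in> K"
  by (simp add: K_def m_def)

lemma K_minus_commute: "x - y \<in> K \<longleftrightarrow> y - x \<in> K"
  using K_minus[of "x - y"] by simp

lemma v3_in_K: "r *\<^sub>R v3 \<in> K"
  by (auto simp: K_def m_def v3)

lemma K_closed: "closed K"
  unfolding K_def m_def by (intro closed_Collect_le continuous_intros)

lemma not_in_K: "a3 \<bullet> x = 0 \<Longrightarrow> x \<noteq> 0 \<Longrightarrow> x \<notin> K"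
  using N_cone N_eq_0 by fastforce

lemma stepD:
  assumes "step a b"
  shows "\<bar>a1 \<bullet> b - l1 * (a1 \<bullet> a)\<bar> \<le> \<delta> * N a" "\<bar>a2 \<bullet> b - l2 * (a2 \<bullet> a)\<bar> \<le> \<delta> * N a"
    "\<bar>a3 \<bullet> b - l3 * (a3 \<bullet> a)\<bar> \<le> \<delta> * N a"
proof -
  have "\<bar>a1 \<bullet> (b - A *v a)\<bar> \<le> \<delta> * N a" "\<bar>a2 \<bullet> (b - A *v a)\<bar> \<le> \<delta> * N a"
    "\<bar>a3 \<bullet> (b - A *v a)\<bar> \<le> \<delta> * N a"
    using assms coord_le_N[of "b - A *v a"] unfolding step_def by (meson order_trans)+
  then show "\<bar>a1 \<bullet> b - l1 * (a1 \<bullet> a)\<bar> \<le> \<delta> * N a" "\<bar>a2 \<bullet> b - l2 * (a2 \<bullet> a)\<bar> \<le> \<delta> * N a"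
    "\<bar>a3 \<bullet> b - l3 * (a3 \<bullet> a)\<bar> \<le> \<delta> * N a"
    by (simp_all add: inner_diff_right eigen)
qed

lemma step_coord:
  assumes "step a b"
  shows "\<bar>a1 \<bullet> b\<bar> \<le> l1 * \<bar>a1 \<bullet> a\<bar> + \<delta> * N a" "\<bar>a2 \<bullet> b\<bar> \<le> l2 * \<bar>a2 \<bullet> a\<bar> + \<delta> * N a"
   "\<bar>a1 \<bullet> b\<bar> \<ge> l1 * \<bar>a1 \<bullet> a\<bar> - \<delta> * N a" "\<bar>a2 \<bullet> b\<bar> \<ge> l2 * \<bar>a2 \<bullet> a\<bar> - \<delta> * N a"
   "\<bar>a3 \<bullet> b\<bar> \<ge> l3 * \<bar>a3 \<bullet> a\<bar> - \<delta> * N a"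
proof -
  have "\<bar>y\<bar> \<le> l * \<bar>x\<bar> + d \<and> l * \<bar>x\<bar> - d \<le> \<bar>y\<bar>" if "\<bar>y - l * x\<bar> \<le> d" "0 < l" for x y l d :: real
  proof -
    have "\<bar>l * x\<bar> = l * \<bar>x\<bar>" using that by (simp add: abs_mult)
    then show ?thesis using that(1) by linarith
  qed
  note * = this[OF stepD(1)[OF assms]] this[OF stepD(2)[OF assms]] this[OF stepD(3)[OF assms]]
  show "\<bar>a1 \<bullet> b\<bar> \<le> l1 * \<bar>a1 \<bullet> a\<bar> + \<delta> * N a" "\<bar>a2 \<bullet> b\<bar> \<le> l2 * \<bar>a2 \<bullet> a\<bar> + \<delta> * N a"
   "\<bar>a1 \<bullet> b\<bar> \<ge> l1 * \<bar>a1 \<bullet> a\<bar> - \<delta> * N a" "\<bar>a2 \<bullet> b\<bar> \<ge> l2 * \<bar>a2 \<bullet> a\<bar> - \<delta> * N a"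
   "\<bar>a3 \<bullet> b\<bar> \<ge> l3 * \<bar>a3 \<bullet> a\<bar> - \<delta> * N a"
    using * ls by auto
qed

text \<open>The image has slope at most \<open>al / be < 1\<close>, so it lies strictly inside
  \<open>K\<close>. This margin later absorbs the error of replacing \<open>v3\<close> by its
  unstable part.\<close>

lemma step_cone_strict:
  assumes "step a b" "a \<in> K"
  shows "m b * be \<le> al * \<bar>a3 \<bullet> b\<bar>" "be * \<bar>a3 \<bullet> a\<bar> \<le> \<bar>a3 \<bullet> b\<bar>"
proof -
  have N: "N a = \<bar>a3 \<bullet> a\<bar>" and le: "\<bar>a1 \<bullet> a\<bar> \<le> \<bar>a3 \<bullet> a\<bar>" "\<bar>a2 \<bullet> a\<bar> \<le> \<bar>a3 \<bullet> a\<bar>"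
    using N_cone[OF assms(2)] assms(2) by (auto simp: K_def m_def)
  show be: "be * \<bar>a3 \<bullet> a\<bar> \<le> \<bar>a3 \<bullet> b\<bar>"
    using step_coord(5)[OF assms(1)] N by (simp add: be_def algebra_simps)
  have "l1 * \<bar>a1 \<bullet> a\<bar> \<le> l2 * \<bar>a3 \<bullet> a\<bar>" "l2 * \<bar>a2 \<bullet> a\<bar> \<le> l2 * \<bar>a3 \<bullet> a\<bar>"
    using ls le by (auto intro: mult_mono)
  then have "m b \<le> al * \<bar>a3 \<bullet> a\<bar>"
    using step_coord(1,2)[OF assms(1)] N by (simp add: al_def m_def algebra_simps)
  then have "m b * be \<le> al * \<bar>a3 \<bullet> a\<bar> * be"
    using al_be by (simp add: mult_right_mono)
  also have "\<dots> \<le> al * \<bar>a3 \<bullet> b\<bar>"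
    using be al_be by (simp add: mult.commute mult.left_commute)
  finally show "m b * be \<le> al * \<bar>a3 \<bullet> b\<bar>" .
qed

text \<open>The signed growth bound serves the intermediate value argument that produces points of
  leaves at a prescribed height.\<close>

lemma step_cone:
  assumes "step a b" "a \<in> K"
  shows "b \<in> K" "be * \<bar>a3 \<bullet> a\<bar> \<le> \<bar>a3 \<bullet> b\<bar>" "a3 \<bullet> a \<ge> 0 \<Longrightarrow> be * (a3 \<bullet> a) \<le> a3 \<bullet> b"
proof -
  note s = step_cone_strict[OF assms]
  show "be * \<bar>a3 \<bullet> a\<bar> \<le> \<bar>a3 \<bullet> b\<bar>" by (rule s)
  have "m b * be \<le> be * \<bar>a3 \<bullet> b\<bar>"
    using s(1) al_be by (meson abs_ge_zero less_imp_le mult_right_mono order_trans)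
  then have "m b \<le> \<bar>a3 \<bullet> b\<bar>"
    using al_be by (simp add: mult.commute)
  then show "b \<in> K" by (simp add: K_def)
  show "be * (a3 \<bullet> a) \<le> a3 \<bullet> b" if "a3 \<bullet> a \<ge> 0"
    using stepD(3)[OF assms(1)] N_cone[OF assms(2)] that by (simp add: be_def algebra_simps)
qed

text \<open>Outside \<open>K\<close> the norm \<open>N\<close> equals \<open>m\<close>, so the error
  of the step is charged to the two slow coordinates alone.\<close>

lemma step_not_cone:
  assumes "step a b" "b \<notin> K"
  shows "a \<notin> K" "m b \<le> al * m a"
proof -
  show a: "a \<notin> K" using step_cone(1) assms by blast
  have "N a = m a" by (rule N_not_cone[OF a])
  moreover have "l1 * \<bar>a1 \<bullet> a\<bar> \<le> l2 * m a" "l2 * \<bar>a2 \<bullet> a\<bar> \<le> l2 * m a"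
    using ls by (auto intro: mult_mono simp: m_def)
  ultimately show "m b \<le> al * m a"
    using step_coord(1,2)[OF assms(1)] by (simp add: al_def m_def algebra_simps)
qed

lemma chain_cone:
  assumes "\<And>i. i < n \<Longrightarrow> step (f i) (f (Suc i))" "f 0 \<in> K"
  shows "f n \<in> K" "be ^ n * \<bar>a3 \<bullet> f 0\<bar> \<le> \<bar>a3 \<bullet> f n\<bar>"
    "a3 \<bullet> f 0 \<ge> 0 \<Longrightarrow> be ^ n * (a3 \<bullet> f 0) \<le> a3 \<bullet> f n"
proof -
  have "f n \<in> K \<and> be ^ n * \<bar>a3 \<bullet> f 0\<bar> \<le> \<bar>a3 \<bullet> f n\<bar> \<and> (a3 \<bullet> f 0 \<ge> 0 \<longrightarrow> be ^ n * (a3 \<bullet> f 0) \<le> a3 \<bullet> f n)"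
    using assms
  proof (induction n)
    case 0
    then show ?case by simp
  next
    case (Suc n)
    then have IH: "f n \<in> K" "be ^ n * \<bar>a3 \<bullet> f 0\<bar> \<le> \<bar>a3 \<bullet> f n\<bar>"
      "(a3 \<bullet> f 0 \<ge> 0 \<longrightarrow> be ^ n * (a3 \<bullet> f 0) \<le> a3 \<bullet> f n)" by auto
    have st: "step (f n) (f (Suc n))" using Suc.prems by simp
    note s = step_cone[OF st IH(1)]
    have "be * (be ^ n * \<bar>a3 \<bullet> f 0\<bar>) \<le> be * \<bar>a3 \<bullet> f n\<bar>"
      using IH(2) al_be by (intro mult_left_mono) auto
    moreover have "be ^ Suc n * (a3 \<bullet> f 0) \<le> a3 \<bullet> f (Suc n)" if "a3 \<bullet> f 0 \<ge> 0"
    proof -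
      have le: "be ^ n * (a3 \<bullet> f 0) \<le> a3 \<bullet> f n" using IH(3) that by simp
      moreover have "0 \<le> be ^ n * (a3 \<bullet> f 0)" using that al_be by simp
      ultimately have "0 \<le> a3 \<bullet> f n" by linarith
      then show ?thesis using s(3) le al_be
        by (smt (verit) mult.assoc mult_left_mono power_Suc)
    qed
    ultimately show ?case using s(1,2) by (simp add: mult.assoc)
  qed
  then show "f n \<in> K" "be ^ n * \<bar>a3 \<bullet> f 0\<bar> \<le> \<bar>a3 \<bullet> f n\<bar>"
    "a3 \<bullet> f 0 \<ge> 0 \<Longrightarrow> be ^ n * (a3 \<bullet> f 0) \<le> a3 \<bullet> f n" by auto
qed

lemma chain_not_cone:
  assumes "\<And>i. i < n \<Longrightarrow> step (f i) (f (Suc i))" "f n \<notin> K"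
  shows "f 0 \<notin> K" "m (f n) \<le> al ^ n * m (f 0)"
proof -
  have "f 0 \<notin> K \<and> m (f n) \<le> al ^ n * m (f 0)"
    using assms
  proof (induction n)
    case 0
    then show ?case by simp
  next
    case (Suc n)
    have st: "step (f n) (f (Suc n))" using Suc.prems by simp
    note s = step_not_cone[OF st Suc.prems(2)]
    have "f 0 \<notin> K" "m (f n) \<le> al ^ n * m (f 0)" using Suc.IH Suc.prems(1) s(1) by auto
    moreover have "al * m (f n) \<le> al * (al ^ n * m (f 0))"
      using calculation(2) al_be by (intro mult_left_mono) auto
    ultimately show ?case using s(2) by (simp add: mult.assoc)
  qed
  then show "f 0 \<notin> K" "m (f n) \<le> al ^ n * m (f 0)" by auto
qed

lemma step_diff: "step (x - y) (F x - F y)"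
  using F_close by (simp add: step_def)

lemma step_dF: "step v (dF F x v)"
  using dF_close by (simp add: step_def)

lemma FG_iter [simp]: "(F ^^ n) ((G ^^ n) x) = x" "(G ^^ n) ((F ^^ n) x) = x"
proof -
  show "(F ^^ n) ((G ^^ n) x) = x"
  proof (induction n)
    case (Suc n)
    have "(F ^^ Suc n) ((G ^^ Suc n) x) = (F ^^ n) (F (G ((G ^^ n) x)))"
      by (simp only: funpow_Suc_right comp_apply funpow_swap1)
    then show ?case using Suc by simp
  qed simp
  show "(G ^^ n) ((F ^^ n) x) = x"
  proof (induction n)
    case (Suc n)
    have "(G ^^ Suc n) ((F ^^ Suc n) x) = (G ^^ n) (G (F ((F ^^ n) x)))"
      by (simp only: funpow_Suc_right comp_apply funpow_swap1)
    then show ?case using Suc by simp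
  qed simp
qed

text \<open>Read from the past to the present, backward iterates form a chain of steps of
  \<open>F\<close>, so the cone estimates for \<open>F\<close> also control
  \<open>G\<close>.\<close>

lemma step_G: "step ((G ^^ Suc n) x - (G ^^ Suc n) y) ((G ^^ n) x - (G ^^ n) y)"
  using step_diff[of "G ((G ^^ n) x)" "G ((G ^^ n) y)"] by simp

lemma dF_FG: "dF F (G x) (dF G x v) = v"
proof -
  have "((F \<circ> G) has_derivative (dF F (G x) \<circ> dF G x)) (at x)"
    by (rule diff_chain_at) (use F_diff G_diff has_derivative_dF in blast)+
  moreover have "F \<circ> G = (\<lambda>x. x)" by auto
  ultimately have "dF (\<lambda>x. x) x = dF F (G x) \<circ> dF G x" using dF_eqI by metis
  moreover have "dF (\<lambda>x. x) x = (\<lambda>x. x)" by (rule dF_eqI) (rule has_derivative_ident)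
  ultimately show ?thesis by (metis comp_apply)
qed

lemma dF_FG_iter: "dF (F ^^ n) ((G ^^ n) x) (dF (G ^^ n) x v) = v"
proof -
  have "(((F ^^ n) \<circ> (G ^^ n)) has_derivative (dF (F ^^ n) ((G ^^ n) x) \<circ> dF (G ^^ n) x)) (at x)"
    by (rule diff_chain_at) (use funpow_differentiable F_diff G_diff has_derivative_dF in blast)+
  moreover have "(F ^^ n) \<circ> (G ^^ n) = (\<lambda>x. x)" by auto
  ultimately have "dF (\<lambda>x. x) x = dF (F ^^ n) ((G ^^ n) x) \<circ> dF (G ^^ n) x" using dF_eqI by metis
  moreover have "dF (\<lambda>x. x) x = (\<lambda>x. x)" by (rule dF_eqI) (rule has_derivative_ident)
  ultimately show ?thesis by (metis comp_apply)
qed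

lemma dF_GF_iter: "dF (G ^^ n) ((F ^^ n) x) (dF (F ^^ n) x v) = v"
proof -
  have "(((G ^^ n) \<circ> (F ^^ n)) has_derivative (dF (G ^^ n) ((F ^^ n) x) \<circ> dF (F ^^ n) x)) (at x)"
    by (rule diff_chain_at) (use funpow_differentiable F_diff G_diff has_derivative_dF in blast)+
  moreover have "(G ^^ n) \<circ> (F ^^ n) = (\<lambda>x. x)" by auto
  ultimately have "dF (\<lambda>x. x) x = dF (G ^^ n) ((F ^^ n) x) \<circ> dF (F ^^ n) x" using dF_eqI by metis
  moreover have "dF (\<lambda>x. x) x = (\<lambda>x. x)" by (rule dF_eqI) (rule has_derivative_ident)
  ultimately show ?thesis by (metis comp_apply)
qed

lemma step_dG: "step (dF (G ^^ Suc n) x v) (dF (G ^^ n) x v)"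
  using step_dF[of "dF G ((G ^^ n) x) (dF (G ^^ n) x v)" "G ((G ^^ n) x)"]
  by (simp add: dF_funpow_Suc[OF G_diff] dF_FG del: funpow.simps)

lemma step_dF_iter: "step (dF (F ^^ n) x v) (dF (F ^^ Suc n) x v)"
  using step_dF by (simp add: dF_funpow_Suc[OF F_diff] del: funpow.simps)

text \<open>Index \<open>n\<close> means \<open>n\<close> steps into the past. By forward
  invariance, membership in \<open>K\<close> at the remotest time carries over to all later times,
  and each step expands.\<close>

lemma backward_cone:
  assumes "\<And>i. i < n \<Longrightarrow> step (f (Suc i)) (f i)" "f n \<in> K"
  shows "be ^ n * N (f n) \<le> N (f 0)"
proof -
  have ch: "step (f (n - i)) (f (n - Suc i))" if "i < n" for i
    using assms(1)[of "n - Suc i"] that by (simp add: Suc_diff_Suc)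
  have *: "f 0 \<in> K" "be ^ n * \<bar>a3 \<bullet> f n\<bar> \<le> \<bar>a3 \<bullet> f 0\<bar>"
    using chain_cone[of n "\<lambda>i. f (n - i)"] ch assms(2) by auto
  then show ?thesis using N_cone assms(2) by simp
qed

lemma backward_not_cone:
  assumes "\<And>i. step (f (Suc i)) (f i)" "f 0 \<notin> K"
  shows "f n \<notin> K" "m (f 0) \<le> al ^ n * N (f n)"
proof -
  have ch: "step (f (n - i)) (f (n - Suc i))" if "i < n" for i
    using assms(1)[of "n - Suc i"] that by (simp add: Suc_diff_Suc)
  show "f n \<notin> K" using chain_not_cone[of n "\<lambda>i. f (n - i)"] ch assms(2) by auto
  then show "m (f 0) \<le> al ^ n * N (f n)"
    using chain_not_cone(2)[of n "\<lambda>i. f (n - i)"] ch assms(2) by (simp add: N_not_cone)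
qed

lemma al_be_tendsto: "(\<lambda>n. (al / be) ^ n) \<longlonglongrightarrow> 0"
  using al_be by (intro LIMSEQ_power_zero) auto

text \<open>A vector outside \<open>K\<close> shrinks in the past at most like
  \<open>al ^ n\<close>, too slowly for the rate \<open>be\<close>. The bound \<open>C\<close> is
  arbitrary, so a rate up to constants already implies membership in the cone.\<close>

lemma backward_fast:
  assumes "\<And>i. step (f (Suc i)) (f i)" "\<And>n. be ^ n * N (f n) \<le> C"
  shows "f n \<in> K"
proof (rule ccontr)
  assume n: "f n \<notin> K"
  define g where "g i = f (n + i)" for i
  have st: "step (g (Suc i)) (g i)" for i using assms(1) by (simp add: g_def)
  have g0: "g 0 \<notin> K" using n by (simp add: g_def)
  have le: "m (g 0) \<le> (al / be) ^ i * (C / be ^ n)" for i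
  proof -
    have "m (g 0) \<le> al ^ i * N (g i)" using backward_not_cone[of g, OF st g0] by simp
    moreover have "N (g i) \<le> C / be ^ (n + i)"
      using assms(2)[of "n + i"] al_be by (simp add: g_def field_simps)
    ultimately have "m (g 0) \<le> al ^ i * (C / be ^ (n + i))"
      using al_be by (meson less_imp_le mult_left_mono order_trans zero_le_power)
    then show ?thesis by (simp add: power_add power_divide field_simps)
  qed
  have "(\<lambda>i. (al / be) ^ i * (C / be ^ n)) \<longlonglongrightarrow> 0 * (C / be ^ n)"
    by (intro tendsto_intros al_be_tendsto)
  then have "m (g 0) \<le> 0" using le by (intro LIMSEQ_le_const) auto
  then have "g 0 \<in> K" by (simp add: K_def)
  with g0 show False by simp
qed

end

subsection \<open>Linearizing coordinates\<close>

text \<open>The limit of \<open>f (P\<^sup>n x) / r\<^sup>n\<close>, as a telescoping series.\<close>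

definition lin_coord :: "('a \<Rightarrow> 'a) \<Rightarrow> ('a \<Rightarrow> real) \<Rightarrow> real \<Rightarrow> 'a \<Rightarrow> real" where
  "lin_coord P f r x = f x + (\<Sum>n. (f ((P ^^ Suc n) x) - r * f ((P ^^ n) x)) / r ^ Suc n)"

text \<open>This upgrades bounded errors to equalities: a defect that is multiplied by
  \<open>r\<close> under iteration and stays bounded must vanish.\<close>

lemma bounded_power_mult_eq_0:
  fixes r d M :: real
  assumes "1 < \<bar>r\<bar>" "\<And>n. \<bar>r ^ n * d\<bar> \<le> M"
  shows "d = 0"
proof (rule ccontr)
  assume "d \<noteq> 0"
  obtain n where "M / \<bar>d\<bar> < \<bar>r\<bar> ^ n"
    using real_arch_pow[OF assms(1)] by blast
  then have "M < \<bar>r ^ n * d\<bar>"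
    using \<open>d \<noteq> 0\<close> by (simp add: abs_mult power_abs pos_divide_less_eq)
  with assms(2)[of n] show False by simp
qed

context
  fixes P :: "'a::topological_space \<Rightarrow> 'a" and f :: "'a \<Rightarrow> real" and r M :: real
  assumes r: "1 < \<bar>r\<bar>" and bd: "\<And>x. \<bar>f (P x) - r * f x\<bar> \<le> M"
begin

lemma lin_coord_term_bound:
  "norm ((f ((P ^^ Suc n) x) - r * f ((P ^^ n) x)) / r ^ Suc n) \<le> M * (1 / \<bar>r\<bar>) ^ Suc n"
proof -
  have "norm ((f ((P ^^ Suc n) x) - r * f ((P ^^ n) x)) / r ^ Suc n)
      = \<bar>f (P ((P ^^ n) x)) - r * f ((P ^^ n) x)\<bar> / \<bar>r\<bar> ^ Suc n"
    by (simp add: abs_mult power_abs)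
  also have "\<dots> \<le> M / \<bar>r\<bar> ^ Suc n"
    by (intro divide_right_mono bd) simp
  finally show ?thesis by (simp add: power_divide)
qed

lemma lin_coord_bound_sums: "(\<lambda>n. M * (1 / \<bar>r\<bar>) ^ Suc n) sums (M / (\<bar>r\<bar> - 1))"
proof -
  have "(\<lambda>n. (1 / \<bar>r\<bar>) ^ n) sums (1 / (1 - 1 / \<bar>r\<bar>))"
    by (rule geometric_sums) (use r in auto)
  then have "(\<lambda>n. (M / \<bar>r\<bar>) * (1 / \<bar>r\<bar>) ^ n) sums ((M / \<bar>r\<bar>) * (1 / (1 - 1 / \<bar>r\<bar>)))"
    by (rule sums_mult)
  moreover have "(M / \<bar>r\<bar>) * (1 / (1 - 1 / \<bar>r\<bar>)) = M / (\<bar>r\<bar> - 1)"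
    using r by (simp add: field_simps)
  moreover have "(\<lambda>n. (M / \<bar>r\<bar>) * (1 / \<bar>r\<bar>) ^ n) = (\<lambda>n. M * (1 / \<bar>r\<bar>) ^ Suc n)"
    by (simp add: fun_eq_iff)
  ultimately show ?thesis by (simp only:)
qed

lemma lin_coord_summable:
  "summable (\<lambda>n. (f ((P ^^ Suc n) x) - r * f ((P ^^ n) x)) / r ^ Suc n)"
  by (rule summable_comparison_test'[OF sums_summable[OF lin_coord_bound_sums]])
    (rule lin_coord_term_bound)

lemma lin_coord_close: "\<bar>lin_coord P f r x - f x\<bar> \<le> M / (\<bar>r\<bar> - 1)"
proof -
  have "norm (\<Sum>n. (f ((P ^^ Suc n) x) - r * f ((P ^^ n) x)) / r ^ Suc n) \<le> (\<Sum>n. M * (1 / \<bar>r\<bar>) ^ Suc n)"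
    by (rule norm_suminf_le) 
      (use lin_coord_term_bound sums_summable[OF lin_coord_bound_sums] in blast)+
  then show ?thesis
    using sums_unique[OF lin_coord_bound_sums] by (simp add: lin_coord_def del: funpow.simps)
qed

text \<open>The series at \<open>P x\<close> is \<open>r\<close> times the tail of the series at
  \<open>x\<close>; the missing head term turns \<open>f (P x)\<close> into
  \<open>r * f x\<close>.\<close>

lemma lin_coord_conj: "lin_coord P f r (P x) = r * lin_coord P f r x"
proof -
  define g where "g n = (f ((P ^^ Suc n) x) - r * f ((P ^^ n) x)) / r ^ Suc n" for n
  have gs: "summable g"
    using lin_coord_summable[of x] by (simp only: g_def[abs_def])
  have "(f ((P ^^ Suc n) (P x)) - r * f ((P ^^ n) (P x))) / r ^ Suc n = r * g (Suc n)" for n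
    using r by (simp add: g_def funpow_swap1 field_simps)
  then have "lin_coord P f r (P x) = f (P x) + (\<Sum>n. r * g (Suc n))"
    by (simp only: lin_coord_def)
  also have "(\<Sum>n. r * g (Suc n)) = r * (\<Sum>n. g (Suc n))"
    using gs by (intro suminf_mult) (simp add: summable_Suc_iff)
  also have "(\<Sum>n. g (Suc n)) = (\<Sum>n. g n) - g 0"
    using gs by (rule suminf_split_head)
  also have "g 0 = (f (P x) - r * f x) / r" by (simp add: g_def)
  finally have "lin_coord P f r (P x) = r * (f x + (\<Sum>n. g n))"
    using r by (simp add: distrib_left right_diff_distrib diff_divide_distrib)
  then show ?thesis by (simp only: lin_coord_def g_def)
qed

lemma lin_coord_conj_iter: "lin_coord P f r ((P ^^ n) x) = r ^ n * lin_coord P f r x"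
  by (induction n) (simp_all add: lin_coord_conj)

lemma continuous_lin_coord:
  assumes "continuous_on UNIV P" "continuous_on UNIV f"
  shows "continuous_on UNIV (lin_coord P f r)"
proof -
  have cP: "continuous_on UNIV (P ^^ n)" for n
  proof (induction n)
    case (Suc n)
    have "continuous_on UNIV (P \<circ> (P ^^ n))"
      using Suc assms(1) by (meson continuous_on_compose continuous_on_subset subset_UNIV)
    then show ?case by simp
  qed (simp add: id_def)
  have cf: "continuous_on UNIV (\<lambda>x. f ((P ^^ n) x))" for n
    using continuous_on_compose2[OF assms(2) cP] by simp
  have ul: "uniform_limit UNIV (\<lambda>n x. \<Sum>i<n. (f ((P ^^ Suc i) x) - r * f ((P ^^ i) x)) / r ^ Suc i)
      (\<lambda>x. \<Sum>n. (f ((P ^^ Suc n) x) - r * f ((P ^^ n) x)) / r ^ Suc n) sequentially"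
    by (rule Weierstrass_m_test[OF _ sums_summable[OF lin_coord_bound_sums]])
      (rule lin_coord_term_bound)
  have "continuous_on UNIV (\<lambda>x. \<Sum>n. (f ((P ^^ Suc n) x) - r * f ((P ^^ n) x)) / r ^ Suc n)"
    by (rule uniform_limit_theorem[OF _ ul])
      (use r in \<open>auto intro!: always_eventually continuous_intros cf simp del: funpow.simps\<close>)
  then show ?thesis
    unfolding lin_coord_def using assms(2) by (intro continuous_intros)
qed


end

section \<open>Linearizing coordinates of the lift and their injectivity\<close>

context near_linear
begin

text \<open>As \<open>l1 < 1\<close>, the defining series converges for the inverse map, with factor
  \<open>1 / l1\<close>; the other two coordinates use forward iteration.\<close>

definition sig where "sig = lin_coord G ((\<bullet>) a1) (1 / l1)"
definition phi where "phi = lin_coord F ((\<bullet>) a2) l2"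
definition psi where "psi = lin_coord F ((\<bullet>) a3) l3"

lemma F_cont: "continuous_on UNIV F"
  using F_diff by (simp add: continuous_at_imp_continuous_on differentiable_imp_continuous_within)

lemma G_cont: "continuous_on UNIV G"
  using G_diff by (simp add: continuous_at_imp_continuous_on differentiable_imp_continuous_within)

lemma Fn_cont: "continuous_on UNIV (F ^^ n)"
  using funpow_differentiable[OF F_diff]
  by (simp add: continuous_at_imp_continuous_on differentiable_imp_continuous_within)

lemma Gn_cont: "continuous_on UNIV (G ^^ n)"
  using funpow_differentiable[OF G_diff]
  by (simp add: continuous_at_imp_continuous_on differentiable_imp_continuous_within)

lemma F_coord_bound:
  "\<bar>a1 \<bullet> F x - l1 * (a1 \<bullet> x)\<bar> \<le> B" "\<bar>a2 \<bullet> F x - l2 * (a2 \<bullet> x)\<bar> \<le> B" "\<bar>a3 \<bullet> F x - l3 * (a3 \<bullet> x)\<bar> \<le> B"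
proof -
  have "\<bar>a1 \<bullet> (F x - A *v x)\<bar> \<le> B" "\<bar>a2 \<bullet> (F x - A *v x)\<bar> \<le> B" "\<bar>a3 \<bullet> (F x - A *v x)\<bar> \<le> B"
    using F_bounded[of x] coord_le_N by (meson order_trans)+
  then show "\<bar>a1 \<bullet> F x - l1 * (a1 \<bullet> x)\<bar> \<le> B" "\<bar>a2 \<bullet> F x - l2 * (a2 \<bullet> x)\<bar> \<le> B"
    "\<bar>a3 \<bullet> F x - l3 * (a3 \<bullet> x)\<bar> \<le> B"
    by (simp_all add: inner_diff_right eigen)
qed

lemma G_coord_bound: "\<bar>a1 \<bullet> G x - 1 / l1 * (a1 \<bullet> x)\<bar> \<le> B / l1"
proof -
  have "l1 * \<bar>a1 \<bullet> G x - 1 / l1 * (a1 \<bullet> x)\<bar> = \<bar>l1 * (a1 \<bullet> G x - 1 / l1 * (a1 \<bullet> x))\<bar>"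
    using ls by (simp add: abs_mult)
  also have "\<dots> = \<bar>a1 \<bullet> F (G x) - l1 * (a1 \<bullet> G x)\<bar>"
    using ls by (simp add: right_diff_distrib)
  also have "\<dots> \<le> B" by (rule F_coord_bound)
  finally show ?thesis using ls by (simp add: field_simps)
qed

lemma rates: "1 < \<bar>1 / l1\<bar>" "1 < \<bar>l2\<bar>" "1 < \<bar>l3\<bar>"
  using ls by auto

text \<open>The sum of the three geometric series bounds, so that one constant serves all
  coordinates.\<close>

definition Q where "Q = B / l1 / (\<bar>1 / l1\<bar> - 1) + B / (\<bar>l2\<bar> - 1) + B / (\<bar>l3\<bar> - 1)"

lemma B_nonneg: "B \<ge> 0"
  using F_coord_bound(1)[of 0] by linarith

lemma coord_close: "\<bar>sig x - a1 \<bullet> x\<bar> \<le> Q" "\<bar>phi x - a2 \<bullet> x\<bar> \<le> Q" "\<bar>psi x - a3 \<bullet> x\<bar> \<le> Q"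
proof -
  have nn: "0 \<le> B / l1 / (\<bar>1 / l1\<bar> - 1)" "0 \<le> B / (\<bar>l2\<bar> - 1)" "0 \<le> B / (\<bar>l3\<bar> - 1)"
    using rates B_nonneg ls by (auto intro!: divide_nonneg_nonneg)
  show "\<bar>sig x - a1 \<bullet> x\<bar> \<le> Q" "\<bar>phi x - a2 \<bullet> x\<bar> \<le> Q" "\<bar>psi x - a3 \<bullet> x\<bar> \<le> Q"
    using lin_coord_close[of _ "(\<bullet>) a1" G, OF rates(1) G_coord_bound, of x]
      lin_coord_close[of _ "(\<bullet>) a2" F, OF rates(2) F_coord_bound(2), of x]
      lin_coord_close[of _ "(\<bullet>) a3" F, OF rates(3) F_coord_bound(3), of x] nn
    unfolding sig_def phi_def psi_def Q_def by linarith+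
qed

lemma coord_conj: "sig ((G ^^ n) x) = (1 / l1) ^ n * sig x" "phi ((F ^^ n) x) = l2 ^ n * phi x"
    "psi ((F ^^ n) x) = l3 ^ n * psi x"
  unfolding sig_def phi_def psi_def
  using lin_coord_conj_iter[of _ "(\<bullet>) a1" G, OF rates(1) G_coord_bound]
    lin_coord_conj_iter[of _ "(\<bullet>) a2" F, OF rates(2) F_coord_bound(2)]
    lin_coord_conj_iter[of _ "(\<bullet>) a3" F, OF rates(3) F_coord_bound(3)] by auto

lemma coord_cont: "continuous_on UNIV sig" "continuous_on UNIV phi" "continuous_on UNIV psi"
proof -
  have c: "continuous_on UNIV ((\<bullet>) a)" for a :: "real^3"
    by (intro continuous_intros)
  show "continuous_on UNIV sig" "continuous_on UNIV phi" "continuous_on UNIV psi"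
    unfolding sig_def phi_def psi_def
    using continuous_lin_coord[of _ "(\<bullet>) a1" G, OF rates(1) G_coord_bound G_cont c]
      continuous_lin_coord[of _ "(\<bullet>) a2" F, OF rates(2) F_coord_bound(2) F_cont c]
      continuous_lin_coord[of _ "(\<bullet>) a3" F, OF rates(3) F_coord_bound(3) F_cont c] by auto
qed

text \<open>The defect of additivity is bounded by \<open>2 * Q\<close> everywhere and is multiplied
  by \<open>r\<close> under \<open>P\<close>, so it is zero. The hypothesis \<open>shift\<close>
  covers both \<open>F\<close>, where \<open>j = A *v k\<close>, and \<open>G\<close>, where
  \<open>A *v j = k\<close>.\<close>

lemma coord_shift:
  assumes P: "\<And>n x. h ((P ^^ n) x) = r ^ n * h x" and r: "1 < \<bar>r\<bar>"
    and close: "\<And>x. \<bar>h x - a \<bullet> x\<bar> \<le> Q"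
    and shift: "\<And>x k. k \<in> lat \<Longrightarrow> \<exists>j\<in>lat. P (x + k) = P x + j \<and> a \<bullet> j = r * (a \<bullet> k)"
    and k: "k \<in> lat"
  shows "h (x + k) = h x + a \<bullet> k"
proof -
  have ex: "\<exists>j\<in>lat. (P ^^ n) (x + k) = (P ^^ n) x + j \<and> a \<bullet> j = r ^ n * (a \<bullet> k)" for n
  proof (induction n)
    case 0
    then show ?case using k by auto
  next
    case (Suc n)
    then obtain j where j: "j \<in> lat" "(P ^^ n) (x + k) = (P ^^ n) x + j" "a \<bullet> j = r ^ n * (a \<bullet> k)"
      by blast
    then show ?case using shift[OF j(1), of "(P ^^ n) x"] by auto
  qed
  have "\<bar>r ^ n * (h (x + k) - h x - a \<bullet> k)\<bar> \<le> 2 * Q" for n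
  proof -
    obtain j where j: "(P ^^ n) (x + k) = (P ^^ n) x + j" "a \<bullet> j = r ^ n * (a \<bullet> k)"
      using ex by blast
    have "r ^ n * (h (x + k) - h x - a \<bullet> k) = h ((P ^^ n) x + j) - h ((P ^^ n) x) - a \<bullet> j"
      using P[of n "x + k"] P[of n x] j by (simp add: algebra_simps)
    then show ?thesis
      using close[of "(P ^^ n) x + j"] close[of "(P ^^ n) x"] unfolding inner_add_right by linarith
  qed
  then have "h (x + k) - h x - a \<bullet> k = 0"
    using bounded_power_mult_eq_0[OF r] by blast
  then show ?thesis by simp
qed

lemma G_lat:
  assumes "A *v j \<in> lat" "j \<in> lat"
  shows "G (x + A *v j) = G x + j"
proof -
  have "F (G x + j) = x + A *v j" using F_lat[OF assms(2)] by simp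
  then show ?thesis by (metis FG(2))
qed

lemma coord_lat:
  assumes "k \<in> lat"
  shows "sig (x + k) = sig x + a1 \<bullet> k" "phi (x + k) = phi x + a2 \<bullet> k" "psi (x + k) = psi x + a3 \<bullet> k"
proof -
  show "phi (x + k) = phi x + a2 \<bullet> k"
    by (rule coord_shift[OF coord_conj(2) rates(2) coord_close(2) _ assms])
      (use F_lat A_in_lat eigen in blast)
  show "psi (x + k) = psi x + a3 \<bullet> k"
    by (rule coord_shift[OF coord_conj(3) rates(3) coord_close(3) _ assms])
      (use F_lat A_in_lat eigen in blast)
  have "\<exists>j\<in>lat. G (x + k) = G x + j \<and> a1 \<bullet> j = 1 / l1 * (a1 \<bullet> k)" if "k \<in> lat" for x k
  proof -
    obtain j where "j \<in> lat" "A *v j = k" using A_lat \<open>k \<in> lat\<close> by blast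
    then show ?thesis using G_lat[of j] that ls eigen(1)[of j] by (intro bexI[of _ j]) auto
  qed
  then show "sig (x + k) = sig x + a1 \<bullet> k"
    by (intro coord_shift[OF coord_conj(1) rates(1) coord_close(1) _ assms])
qed

lemma Gn_lat: "k \<in> lat \<Longrightarrow> \<exists>j\<in>lat. \<forall>x. (G ^^ n) (x + k) = (G ^^ n) x + j"
proof (induction n)
  case 0
  then show ?case by auto
next
  case (Suc n)
  then obtain j where j: "j \<in> lat" "\<And>x. (G ^^ n) (x + k) = (G ^^ n) x + j" by blast
  obtain i where i: "i \<in> lat" "A *v i = j" using A_lat j(1) by blast
  have "\<forall>x. (G ^^ Suc n) (x + k) = (G ^^ Suc n) x + i"
    using j G_lat i by auto
  with i show ?case by blast
qed

text \<open>A second cone, around the center-unstable plane: it is forward invariant and expands by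
  at least \<open>l2 - \<delta> > 1\<close>.\<close>

lemma step_cu:
  assumes "step a b" "\<bar>a1 \<bullet> a\<bar> \<le> max \<bar>a2 \<bullet> a\<bar> \<bar>a3 \<bullet> a\<bar>"
  shows "\<bar>a1 \<bullet> b\<bar> \<le> max \<bar>a2 \<bullet> b\<bar> \<bar>a3 \<bullet> b\<bar>"
    "(l2 - \<delta>) * max \<bar>a2 \<bullet> a\<bar> \<bar>a3 \<bullet> a\<bar> \<le> max \<bar>a2 \<bullet> b\<bar> \<bar>a3 \<bullet> b\<bar>"
proof -
  define p where "p = max \<bar>a2 \<bullet> a\<bar> \<bar>a3 \<bullet> a\<bar>"
  have N: "N a = p" using assms(2) by (simp add: N_def p_def)
  have p0: "p \<ge> 0" by (simp add: p_def)
  note s = step_coord[OF assms(1), unfolded N]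
  have "(l2 - \<delta>) * p \<le> \<bar>a2 \<bullet> b\<bar> \<or> (l2 - \<delta>) * p \<le> \<bar>a3 \<bullet> b\<bar>"
  proof (cases "p = \<bar>a2 \<bullet> a\<bar>")
    case True
    then show ?thesis using s(4) by (simp add: algebra_simps)
  next
    case False
    then have "p = \<bar>a3 \<bullet> a\<bar>" unfolding p_def by linarith
    moreover have "l2 * p \<le> l3 * p" using p0 ls by (intro mult_right_mono) auto
    ultimately show ?thesis using s(5) by (simp add: algebra_simps)
  qed
  then show 2: "(l2 - \<delta>) * max \<bar>a2 \<bullet> a\<bar> \<bar>a3 \<bullet> a\<bar> \<le> max \<bar>a2 \<bullet> b\<bar> \<bar>a3 \<bullet> b\<bar>"
    unfolding p_def[symmetric] by (meson le_max_iff_disj)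
  have "l1 * \<bar>a1 \<bullet> a\<bar> \<le> l1 * p" using assms(2) ls by (simp add: p_def)
  then have "\<bar>a1 \<bullet> b\<bar> \<le> (l1 + \<delta>) * p" using s(1) by (simp add: algebra_simps)
  also have "\<dots> \<le> (l2 - \<delta>) * p" using p0 ls by (intro mult_right_mono) auto
  finally show "\<bar>a1 \<bullet> b\<bar> \<le> max \<bar>a2 \<bullet> b\<bar> \<bar>a3 \<bullet> b\<bar>" using 2 by (simp add: p_def)
qed

text \<open>The complementary stable cone is backward invariant, and its vectors grow in the past by
  at least \<open>1 / (l1 + \<delta>)\<close>.\<close>

lemma step_s:
  assumes "step a b" "max \<bar>a2 \<bullet> b\<bar> \<bar>a3 \<bullet> b\<bar> < \<bar>a1 \<bullet> b\<bar>"
  shows "max \<bar>a2 \<bullet> a\<bar> \<bar>a3 \<bullet> a\<bar> < \<bar>a1 \<bullet> a\<bar>" "\<bar>a1 \<bullet> b\<bar> \<le> (l1 + \<delta>) * \<bar>a1 \<bullet> a\<bar>"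
proof -
  show 1: "max \<bar>a2 \<bullet> a\<bar> \<bar>a3 \<bullet> a\<bar> < \<bar>a1 \<bullet> a\<bar>"
    using step_cu(1)[OF assms(1)] assms(2) by (meson not_less)
  have "N a = \<bar>a1 \<bullet> a\<bar>" unfolding N_def using 1 by (simp add: max_absorb1)
  then show "\<bar>a1 \<bullet> b\<bar> \<le> (l1 + \<delta>) * \<bar>a1 \<bullet> a\<bar>"
    using step_coord(1)[OF assms(1)] by (simp add: algebra_simps)
qed

text \<open>A nonzero difference either lies in the center-unstable cone and grows without bound in
  the future, or lies in the stable cone and does so in the past.\<close>

lemma expansive:
  assumes "\<And>n. N ((F ^^ n) p - (F ^^ n) q) \<le> C" "\<And>n. N ((G ^^ n) p - (G ^^ n) q) \<le> C"
  shows "p = q"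
proof (cases "\<bar>a1 \<bullet> (p - q)\<bar> \<le> max \<bar>a2 \<bullet> (p - q)\<bar> \<bar>a3 \<bullet> (p - q)\<bar>")
  case True
  define g where "g n = (F ^^ n) p - (F ^^ n) q" for n
  have st: "step (g n) (g (Suc n))" for n using step_diff by (simp add: g_def)
  have gr: "\<bar>a1 \<bullet> g n\<bar> \<le> max \<bar>a2 \<bullet> g n\<bar> \<bar>a3 \<bullet> g n\<bar> \<and>
      (l2 - \<delta>) ^ n * max \<bar>a2 \<bullet> g 0\<bar> \<bar>a3 \<bullet> g 0\<bar> \<le> max \<bar>a2 \<bullet> g n\<bar> \<bar>a3 \<bullet> g n\<bar>" for n
  proof (induction n)
    case 0
    then show ?case using True by (simp add: g_def)
  next
    case (Suc n)
    have "(l2 - \<delta>) * ((l2 - \<delta>) ^ n * max \<bar>a2 \<bullet> g 0\<bar> \<bar>a3 \<bullet> g 0\<bar>) \<le> (l2 - \<delta>) * max \<bar>a2 \<bullet> g n\<bar> \<bar>a3 \<bullet> g n\<bar>"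
      using Suc ls by (intro mult_left_mono) auto
    then show ?case using step_cu[OF st, of n] Suc by (simp add: mult.assoc)
  qed
  have "\<bar>(l2 - \<delta>) ^ n * max \<bar>a2 \<bullet> g 0\<bar> \<bar>a3 \<bullet> g 0\<bar>\<bar> \<le> C" for n
  proof -
    have "\<bar>(l2 - \<delta>) ^ n * max \<bar>a2 \<bullet> g 0\<bar> \<bar>a3 \<bullet> g 0\<bar>\<bar> = (l2 - \<delta>) ^ n * max \<bar>a2 \<bullet> g 0\<bar> \<bar>a3 \<bullet> g 0\<bar>"
      using ls by (intro abs_of_nonneg) (auto simp: le_max_iff_disj)
    also have "\<dots> \<le> max \<bar>a2 \<bullet> g n\<bar> \<bar>a3 \<bullet> g n\<bar>" using gr by blast
    also have "\<dots> \<le> N (g n)" by (simp add: N_def)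
    also have "\<dots> \<le> C" using assms(1) by (simp add: g_def)
    finally show ?thesis .
  qed
  moreover have "1 < \<bar>l2 - \<delta>\<bar>" using ls by simp
  ultimately have "max \<bar>a2 \<bullet> g 0\<bar> \<bar>a3 \<bullet> g 0\<bar> = 0"
    using bounded_power_mult_eq_0 by blast
  then have "N (g 0) = 0" using gr[of 0] by (simp add: N_def)
  then show ?thesis using N_eq_0 by (simp add: g_def)
next
  case False
  define g where "g n = (G ^^ n) p - (G ^^ n) q" for n
  have st: "step (g (Suc n)) (g n)" for n using step_G unfolding g_def by blast
  have l: "0 < l1 + \<delta>" using ls by simp
  have gr: "max \<bar>a2 \<bullet> g n\<bar> \<bar>a3 \<bullet> g n\<bar> < \<bar>a1 \<bullet> g n\<bar> \<and> \<bar>a1 \<bullet> g 0\<bar> \<le> (l1 + \<delta>) ^ n * \<bar>a1 \<bullet> g n\<bar>" for n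
  proof (induction n)
    case 0
    then show ?case using False by (simp add: g_def not_le del: max_less_iff_conj)
  next
    case (Suc n)
    note s = step_s[OF st, of n]
    have "(l1 + \<delta>) ^ n * \<bar>a1 \<bullet> g n\<bar> \<le> (l1 + \<delta>) ^ n * ((l1 + \<delta>) * \<bar>a1 \<bullet> g (Suc n)\<bar>)"
      using s(2) Suc l by (intro mult_left_mono) auto
    then show ?case using s(1) Suc by (simp add: algebra_simps)
  qed
  have "\<bar>(1 / (l1 + \<delta>)) ^ n * (a1 \<bullet> g 0)\<bar> \<le> C" for n
  proof -
    have "\<bar>(1 / (l1 + \<delta>)) ^ n * (a1 \<bullet> g 0)\<bar> = \<bar>a1 \<bullet> g 0\<bar> / (l1 + \<delta>) ^ n"
      using l by (simp add: abs_mult power_divide power_abs)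
    also have "\<dots> \<le> \<bar>a1 \<bullet> g n\<bar>" using gr[of n] l by (simp add: field_simps)
    also have "\<dots> \<le> N (g n)" by (simp add: N_def)
    also have "\<dots> \<le> C" using assms(2) by (simp add: g_def)
    finally show ?thesis .
  qed
  moreover have "1 < \<bar>1 / (l1 + \<delta>)\<bar>" using ls l by simp
  ultimately have "a1 \<bullet> g 0 = 0" using bounded_power_mult_eq_0 by blast
  then show ?thesis using gr[of 0] by simp
qed

text \<open>Points with equal coordinates keep equal coordinates along their whole orbits, so the
  orbits stay within \<open>2 * Q\<close> of each other and expansivity applies.\<close>

lemma coord_inj:
  assumes "sig p = sig q" "phi p = phi q" "psi p = psi q"
  shows "p = q"
proof (rule expansive)
  have conj_inv: "sig ((F ^^ n) x) = l1 ^ n * sig x" "phi ((G ^^ n) x) = phi x / l2 ^ n"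
    "psi ((G ^^ n) x) = psi x / l3 ^ n" for n x
    using coord_conj(1)[of n "(F ^^ n) x"] coord_conj(2)[of n "(G ^^ n) x"]
      coord_conj(3)[of n "(G ^^ n) x"] ls by (simp_all add: field_simps)
  have *: "N (x - y) \<le> 2 * Q" if "sig x = sig y" "phi x = phi y" "psi x = psi y" for x y
    using coord_close[of x] coord_close[of y] that unfolding N_def inner_diff_right by auto
  show "N ((F ^^ n) p - (F ^^ n) q) \<le> 2 * Q" "N ((G ^^ n) p - (G ^^ n) q) \<le> 2 * Q" for n
    by (rule *; simp add: conj_inv coord_conj assms)+
qed

end

subsection \<open>Strong unstable leaves\<close>

text \<open>The order of choices matters: \<open>n\<close> is fixed first to make \<open>r n\<close>
  small, and only then the limit of \<open>h n\<close> is taken.\<close>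

lemma tendsto_0_family:
  fixes d :: "'a \<Rightarrow> real" and r :: "nat \<Rightarrow> real"
  assumes le: "\<And>n. eventually (\<lambda>x. d x \<le> r n + h n x) F" and nn: "\<And>x. 0 \<le> d x"
    and h: "\<And>n. (h n \<longlongrightarrow> 0) F" and r: "r \<longlonglongrightarrow> 0"
  shows "(d \<longlongrightarrow> 0) F"
proof (rule tendstoI)
  fix e :: real
  assume e: "e > 0"
  have "eventually (\<lambda>n. r n < e / 2) sequentially"
    using r e by (intro order_tendstoD(2)[OF r]) simp
  then obtain n where n: "r n < e / 2" using eventually_happens by force
  have "eventually (\<lambda>x. h n x < e / 2) F"
    using e by (intro order_tendstoD(2)[OF h]) simp
  with le[of n] show "eventually (\<lambda>x. dist (d x) 0 < e) F"
  proof eventually_elim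
    case (elim x)
    then show ?case using n nn[of x] by simp
  qed
qed

context near_linear
begin

lemma N_tendsto:
  assumes "(f \<longlongrightarrow> l) \<F>"
  shows "((\<lambda>x. N (f x)) \<longlongrightarrow> N l) \<F>"
  unfolding N_def by (intro tendsto_intros assms)

lemma tendsto_N_iff: "(f \<longlongrightarrow> l) \<F> \<longleftrightarrow> ((\<lambda>x. N (f x - l)) \<longlongrightarrow> 0) \<F>"
proof
  assume "(f \<longlongrightarrow> l) \<F>"
  then have "((\<lambda>x. f x - l) \<longlongrightarrow> l - l) \<F>" by (intro tendsto_intros)
  from N_tendsto[OF this] show "((\<lambda>x. N (f x - l)) \<longlongrightarrow> 0) \<F>" by simp
next
  assume "((\<lambda>x. N (f x - l)) \<longlongrightarrow> 0) \<F>"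
  from tendsto_mult_right_zero[OF this] have "((\<lambda>x. c * N (f x - l)) \<longlongrightarrow> 0) \<F>" .
  then have "((\<lambda>x. f x - l) \<longlongrightarrow> 0) \<F>"
    by (rule Lim_null_comparison[rotated]) (intro always_eventually allI c(2))
  then show "(f \<longlongrightarrow> l) \<F>" using LIM_zero_iff by blast
qed

text \<open>\<open>W z\<close> is the strong unstable leaf of \<open>z\<close> (see \<open>leaf_eq_W\<close>); it is a graph over the coordinate
  \<open>a3\<close>, parametrized by \<open>om z\<close>.\<close>

definition W where "W z = {z'. \<forall>n. (G ^^ n) z' - (G ^^ n) z \<in> K}"

lemma W_rate:
  assumes "z' \<in> W z"
  shows "be ^ n * N ((G ^^ n) z' - (G ^^ n) z) \<le> N (z' - z)"
  using backward_cone[of n "\<lambda>n. (G ^^ n) z' - (G ^^ n) z"] assms step_G unfolding W_def by simp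

lemma W_I:
  assumes "\<And>n. be ^ n * N ((G ^^ n) z' - (G ^^ n) z) \<le> C"
  shows "z' \<in> W z"
  using backward_fast[of "\<lambda>n. (G ^^ n) z' - (G ^^ n) z"] assms step_G unfolding W_def by blast

lemma W_refl: "z \<in> W z"
  by (simp add: W_def K_def m_def)

lemma W_sym: "z' \<in> W z \<Longrightarrow> z \<in> W z'"
  unfolding W_def using K_minus_commute by blast

text \<open>The cone is not closed under addition. The argument therefore passes through contraction
  rates, which do add up, and returns to the cone by \<open>W_I\<close>.\<close>

lemma W_trans:
  assumes "z' \<in> W z" "z'' \<in> W z'"
  shows "z'' \<in> W z"
proof (rule W_I)
  fix n
  have "N ((G ^^ n) z'' - (G ^^ n) z) \<le> N ((G ^^ n) z'' - (G ^^ n) z') + N ((G ^^ n) z' - (G ^^ n) z)"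
    using N_triangle[of "(G ^^ n) z'' - (G ^^ n) z'" "(G ^^ n) z' - (G ^^ n) z"] by simp
  then have "be ^ n * N ((G ^^ n) z'' - (G ^^ n) z)
      \<le> be ^ n * (N ((G ^^ n) z'' - (G ^^ n) z') + N ((G ^^ n) z' - (G ^^ n) z))"
    using al_be by (intro mult_left_mono) auto
  then show "be ^ n * N ((G ^^ n) z'' - (G ^^ n) z) \<le> N (z'' - z') + N (z' - z)"
    using W_rate[OF assms(1), of n] W_rate[OF assms(2), of n] by (simp add: distrib_left)
qed

lemma W_N:
  assumes "p \<in> W z" "q \<in> W z"
  shows "N (p - q) = \<bar>a3 \<bullet> p - a3 \<bullet> q\<bar>"
proof -
  have "p \<in> W q" using assms W_sym W_trans by blast
  then have "(G ^^ 0) p - (G ^^ 0) q \<in> K" unfolding W_def by blast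
  then show ?thesis using N_cone[of "p - q"] by (simp add: inner_diff_right)
qed

lemma G_of_F_iter: "j \<le> n \<Longrightarrow> (G ^^ j) ((F ^^ n) y) = (F ^^ (n - j)) y"
  using FG_iter(2)[of j "(F ^^ (n - j)) y"] funpow_add[of j "n - j" F] by simp

text \<open>A graph transform: the line in direction \<open>v3\<close> through the
  \<open>n\<close>-th preimage of \<open>z\<close> is pushed forward \<open>n\<close> times. It
  stays in the cone of \<open>z\<close>, and its height covers all reals.\<close>

lemma W_approx:
  "\<exists>p. a3 \<bullet> p = t \<and> (\<forall>j\<le>n. (G ^^ j) p - (G ^^ j) z \<in> K)"
proof -
  define q where "q \<tau> = (G ^^ n) z + \<tau> *\<^sub>R v3" for \<tau>
  define g where "g \<tau> = a3 \<bullet> (F ^^ n) (q \<tau>)" for \<tau>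
  have cone: "(F ^^ i) (q \<tau>) - (F ^^ i) ((G ^^ n) z) \<in> K" for i \<tau>
    by (rule chain_cone(1)[of i "\<lambda>i. (F ^^ i) (q \<tau>) - (F ^^ i) ((G ^^ n) z)"])
      (simp_all add: step_diff q_def v3_in_K)
  have "be ^ n * (\<tau> * (a3 \<bullet> v3)) \<le> a3 \<bullet> ((F ^^ n) (q \<tau>) - z)" if "\<tau> \<ge> 0" for \<tau>
    using chain_cone(3)[of n "\<lambda>i. (F ^^ i) (q \<tau>) - (F ^^ i) ((G ^^ n) z)"] that
    by (simp add: step_diff q_def v3_in_K v3)
  then have up: "be ^ n * \<tau> \<le> g \<tau> - a3 \<bullet> z" if "\<tau> \<ge> 0" for \<tau>
    using that by (simp add: v3 g_def inner_diff_right)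
  have "be ^ n * - (\<tau> * (a3 \<bullet> v3)) \<le> a3 \<bullet> (z - (F ^^ n) (q \<tau>))" if "\<tau> \<le> 0" for \<tau>
    using chain_cone(3)[of n "\<lambda>i. (F ^^ i) ((G ^^ n) z) - (F ^^ i) (q \<tau>)"] that v3_in_K[of "- \<tau>"]
    by (simp add: step_diff q_def v3)
  then have down: "be ^ n * - \<tau> \<le> a3 \<bullet> z - g \<tau>" if "\<tau> \<le> 0" for \<tau>
    using that by (simp add: v3 g_def inner_diff_right)
  \<comment> \<open>Expansion by \<open>be ^ n \<ge> 1\<close> makes the parameters
    \<open>- T\<close> and \<open>T\<close> reach heights on both sides of \<open>t\<close>.\<close>
  define T where "T = \<bar>t - a3 \<bullet> z\<bar>"
  have "1 * T \<le> be ^ n * T"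
    using al_be by (intro mult_right_mono one_le_power) (auto simp: T_def)
  then have "g (- T) \<le> t" "t \<le> g T"
    using up[of T] down[of "- T"] by (auto simp: T_def)
  moreover have "continuous_on {- T..T} g"
    unfolding g_def q_def
    by (intro continuous_intros continuous_on_compose2[OF Fn_cont]) auto
  ultimately obtain \<tau> where \<tau>: "g \<tau> = t"
    using IVT'[of g "- T" t T] by (auto simp: T_def)
  have "(G ^^ j) ((F ^^ n) (q \<tau>)) - (G ^^ j) z \<in> K" if "j \<le> n" for j
    using cone[of "n - j" \<tau>] G_of_F_iter[OF that, of "q \<tau>"] G_of_F_iter[OF that, of "(G ^^ n) z"] by simp
  then show ?thesis using \<tau> by (auto simp: g_def)
qed

text \<open>A limit point of the approximations works: the cone condition at time 0 confines them to
  a ball, and each condition passes to the limit because \<open>K\<close> is closed.\<close>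

lemma W_exists: "\<exists>z'\<in>W z. a3 \<bullet> z' = t"
proof -
  obtain p where p: "\<And>n. a3 \<bullet> p n = t" "\<And>n j. j \<le> n \<Longrightarrow> (G ^^ j) (p n) - (G ^^ j) z \<in> K"
    using W_approx[of t _ z] by metis
  have "p n \<in> cball z (c * \<bar>t - a3 \<bullet> z\<bar>)" for n
  proof -
    have "p n - z \<in> K" using p(2)[of 0 n] by simp
    then have "N (p n - z) = \<bar>t - a3 \<bullet> z\<bar>" using N_cone p(1) by (simp add: inner_diff_right)
    then show ?thesis using c(2)[of "p n - z"] by (simp add: dist_norm norm_minus_commute)
  qed
  then obtain l r where r: "strict_mono r" "(p \<circ> r) \<longlonglongrightarrow> l"
    using compact_cball compact_def by metis
  have "(G ^^ j) l - (G ^^ j) z \<in> K" for j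
  proof (rule Lim_in_closed_set[OF K_closed])
    have "isCont (G ^^ j) l"
      using Gn_cont continuous_on_eq_continuous_at by blast
    then have "(\<lambda>n. (G ^^ j) ((p \<circ> r) n)) \<longlonglongrightarrow> (G ^^ j) l"
      using r(2) by (rule isCont_tendsto_compose)
    then show "(\<lambda>n. (G ^^ j) ((p \<circ> r) n) - (G ^^ j) z) \<longlonglongrightarrow> (G ^^ j) l - (G ^^ j) z"
      by (intro tendsto_intros)
    show "\<forall>\<^sub>F n in sequentially. (G ^^ j) ((p \<circ> r) n) - (G ^^ j) z \<in> K"
    proof (rule eventually_mono[OF eventually_ge_at_top[of j]])
      fix n assume "j \<le> n"
      then have "j \<le> r n" using r(1) by (meson order_trans seq_suble)
      then show "(G ^^ j) ((p \<circ> r) n) - (G ^^ j) z \<in> K" using p(2) by simp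
    qed
  qed simp
  then have "l \<in> W z" by (simp add: W_def)
  moreover have "(\<lambda>n. a3 \<bullet> (p \<circ> r) n) \<longlonglongrightarrow> a3 \<bullet> l"
    using r(2) by (intro tendsto_intros)
  then have "a3 \<bullet> l = t" using p(1) by (simp add: LIMSEQ_const_iff)
  ultimately show ?thesis by blast
qed

definition om where "om z t = (SOME z'. z' \<in> W z \<and> a3 \<bullet> z' = t)"

lemma om: "om z t \<in> W z" "a3 \<bullet> om z t = t"
proof -
  have "\<exists>z'. z' \<in> W z \<and> a3 \<bullet> z' = t" using W_exists by blast
  from someI_ex[OF this] show "om z t \<in> W z" "a3 \<bullet> om z t = t" unfolding om_def by blast+
qed

lemma om_eqI: "z' \<in> W z \<Longrightarrow> om z (a3 \<bullet> z') = z'"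
  using W_N[of "om z (a3 \<bullet> z')" z z'] N_eq_0 by (simp add: om)

lemma om_N: "N (om z s - om z t) = \<bar>s - t\<bar>"
  using W_N[of "om z s" z "om z t"] by (simp add: om)

lemma om_cont: "continuous_on UNIV (om z)"
  unfolding continuous_on_def
proof
  fix t :: real
  have "isCont (\<lambda>s. \<bar>s - t\<bar>) t" by (intro continuous_intros)
  then have "((\<lambda>s. \<bar>s - t\<bar>) \<longlongrightarrow> \<bar>t - t\<bar>) (at t)" by (simp only: isCont_def)
  then show "(om z \<longlongrightarrow> om z t) (at t)" by (simp add: tendsto_N_iff om_N)
qed

text \<open>A nonzero difference of points at the same height lies outside \<open>K\<close>, so it
  shrinks slowly in the past. Against the fast contraction in \<open>W_rate\<close>, this forces
  points at equal height to agree.\<close>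

lemma separation:
  assumes "a3 \<bullet> (p - q) = 0"
  shows "N (p - q) \<le> al ^ n * N ((G ^^ n) p - (G ^^ n) q)"
proof (cases "p = q")
  case False
  then have "p - q \<notin> K" using not_in_K assms by simp
  with backward_not_cone(2)[of "\<lambda>n. (G ^^ n) p - (G ^^ n) q" n] step_G N_not_cone show ?thesis by simp
qed simp

lemma separation_dF:
  assumes "a3 \<bullet> v = 0"
  shows "N v \<le> al ^ n * N (dF (G ^^ n) x v)"
proof (cases "v = 0")
  case False
  then have "v \<notin> K" using not_in_K assms by simp
  with backward_not_cone(2)[of "\<lambda>n. dF (G ^^ n) x v" n] step_dG N_not_cone show ?thesis
    by (simp only: dF_funpow_0 not_False_eq_True) 
next
  case True
  then show ?thesis using al_be by simp
qed

text \<open>After \<open>n\<close> backward steps both points are within order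
  \<open>be ^ (- n)\<close> of the iterates of their base points, which are close by continuity.
  Returning by \<open>separation\<close> costs only \<open>al ^ n\<close>.\<close>

lemma om_tendsto:
  assumes "X \<longlonglongrightarrow> z"
  shows "(\<lambda>i. om (X i) t) \<longlonglongrightarrow> om z t"
  unfolding tendsto_N_iff
proof (rule tendsto_0_family)
  define D where "D = \<bar>t - a3 \<bullet> z\<bar>"
  have "(\<lambda>i. \<bar>t - a3 \<bullet> X i\<bar>) \<longlonglongrightarrow> D" unfolding D_def by (intro tendsto_intros assms)
  \<comment> \<open>The heights above the points \<open>X i\<close> are only eventually below
    \<open>D + 1\<close>; together with \<open>D\<close> for the limit leaf this gives the constant
    \<open>2 * D + 1\<close>.\<close>
  then have ev: "\<forall>\<^sub>F i in sequentially. \<bar>t - a3 \<bullet> X i\<bar> < D + 1"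
    by (rule order_tendstoD) simp
  show "\<forall>\<^sub>F i in sequentially. N (om (X i) t - om z t)
      \<le> (al / be) ^ n * (2 * D + 1) + al ^ n * N ((G ^^ n) (X i) - (G ^^ n) z)" for n
    using ev
  proof eventually_elim
    case (elim i)
    define p where "p = om (X i) t"
    define q where "q = om z t"
    have bn: "0 < be ^ n" using al_be by simp
    have "be ^ n * N ((G ^^ n) p - (G ^^ n) (X i)) \<le> D + 1"
      using W_rate[of p "X i" n] W_N[of p "X i" "X i"] elim by (simp add: p_def om W_refl)
    moreover have "be ^ n * N ((G ^^ n) q - (G ^^ n) z) \<le> D"
      using W_rate[of q z n] W_N[of q z z] by (simp add: q_def om W_refl D_def)
    ultimately have b: "N ((G ^^ n) p - (G ^^ n) (X i)) + N ((G ^^ n) q - (G ^^ n) z) \<le> (2 * D + 1) / be ^ n"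
      using bn by (simp add: field_simps)
    have "N ((G ^^ n) p - (G ^^ n) q) \<le> N ((G ^^ n) p - (G ^^ n) (X i)) + N ((G ^^ n) (X i) - (G ^^ n) q)"
      "N ((G ^^ n) (X i) - (G ^^ n) q) \<le> N ((G ^^ n) (X i) - (G ^^ n) z) + N ((G ^^ n) q - (G ^^ n) z)"
      using N_triangle[of "(G ^^ n) p - (G ^^ n) (X i)" "(G ^^ n) (X i) - (G ^^ n) q"]
        N_triangle_diff[of "(G ^^ n) (X i) - (G ^^ n) z" "(G ^^ n) q - (G ^^ n) z"] by simp_all
    with b have "N ((G ^^ n) p - (G ^^ n) q) \<le> (2 * D + 1) / be ^ n + N ((G ^^ n) (X i) - (G ^^ n) z)"
      by linarith
    then have "al ^ n * N ((G ^^ n) p - (G ^^ n) q) \<le> al ^ n * ((2 * D + 1) / be ^ n + N ((G ^^ n) (X i) - (G ^^ n) z))"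
      using al_be by (intro mult_left_mono) auto
    moreover have "N (p - q) \<le> al ^ n * N ((G ^^ n) p - (G ^^ n) q)"
      by (rule separation) (simp add: p_def q_def om inner_diff_right)
    ultimately show ?case
      unfolding p_def[symmetric] q_def[symmetric] by (simp add: distrib_left power_divide add_divide_distrib)
  qed
  show "(\<lambda>i. al ^ n * N ((G ^^ n) (X i) - (G ^^ n) z)) \<longlonglongrightarrow> 0" for n
  proof -
    have "isCont (G ^^ n) z"
      using Gn_cont continuous_on_eq_continuous_at by blast
    then have "(\<lambda>i. (G ^^ n) (X i)) \<longlonglongrightarrow> (G ^^ n) z"
      using assms by (rule isCont_tendsto_compose)
    then have "(\<lambda>i. N ((G ^^ n) (X i) - (G ^^ n) z)) \<longlonglongrightarrow> 0" by (simp add: tendsto_N_iff)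
    from tendsto_mult_right_zero[OF this] show ?thesis .
  qed
  have "(\<lambda>n. (al / be) ^ n * (2 * D + 1)) \<longlonglongrightarrow> 0 * (2 * D + 1)"
    by (intro tendsto_intros al_be_tendsto)
  then show "(\<lambda>n. (al / be) ^ n * (2 * D + 1)) \<longlonglongrightarrow> 0" by simp
qed simp

lemma W_lat:
  assumes "k \<in> lat" "z' \<in> W z"
  shows "z' + k \<in> W (z + k)"
  unfolding W_def
proof (intro CollectI allI)
  fix n
  obtain j where "\<And>x. (G ^^ n) (x + k) = (G ^^ n) x + j" using Gn_lat[OF assms(1)] by blast
  then show "(G ^^ n) (z' + k) - (G ^^ n) (z + k) \<in> K" using assms(2) by (simp add: W_def)
qed

lemma W_F: 
  assumes "z' \<in> W z" 
  shows "F z' \<in> W (F z)"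
  unfolding W_def
proof (intro CollectI allI)
  fix n
  have W: "(G ^^ n) z' - (G ^^ n) z \<in> K" for n using assms by (simp add: W_def)
  show "(G ^^ n) (F z') - (G ^^ n) (F z) \<in> K"
  proof (cases n)
    case 0
    then show ?thesis using step_cone(1)[OF step_diff, of z' z] W[of 0] by simp
  next
    case (Suc k)
    then show ?thesis using W[of k] by (simp only: funpow_Suc_right comp_apply FG)
  qed
qed

lemma W_Fn: "z' \<in> W z \<Longrightarrow> (F ^^ n) z' \<in> W ((F ^^ n) z)"
  by (induction n) (auto intro: W_F)

lemma lat_minus: "k \<in> lat \<Longrightarrow> - k \<in> lat"
  by (simp add: lat_def)

text \<open>Backward iteration multiplies the difference of \<open>sig\<close> by
  \<open>1 / l1 > 1\<close>, while points of one unstable leaf stay close.\<close>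

lemma sig_W:
  assumes "z' \<in> W z"
  shows "sig z' = sig z"
proof -
  have "\<bar>(1 / l1) ^ n * (sig z' - sig z)\<bar> \<le> 2 * Q + N (z' - z)" for n
  proof -
    have "(1 / l1) ^ n * (sig z' - sig z) = sig ((G ^^ n) z') - sig ((G ^^ n) z)"
      by (simp add: coord_conj right_diff_distrib)
    moreover have "\<bar>a1 \<bullet> (G ^^ n) z' - a1 \<bullet> (G ^^ n) z\<bar> \<le> N (z' - z)"
    proof -
      have "1 * N ((G ^^ n) z' - (G ^^ n) z) \<le> be ^ n * N ((G ^^ n) z' - (G ^^ n) z)"
        using al_be by (intro mult_right_mono one_le_power) auto
      then show ?thesis
        using W_rate[OF assms, of n] coord_le_N(1)[of "(G ^^ n) z' - (G ^^ n) z"]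
        by (simp add: inner_diff_right)
    qed
    ultimately show ?thesis
      using coord_close(1)[of "(G ^^ n) z'"] coord_close(1)[of "(G ^^ n) z"] by linarith
  qed
  then show ?thesis using bounded_power_mult_eq_0[OF rates(1)] by force
qed

text \<open>Along the leaf \<open>psi\<close> stays within \<open>Q\<close> of the height parameter,
  so the intermediate value theorem applies.\<close>

lemma psi_W_surj: "\<exists>z'\<in>W z. psi z' = t"
proof -
  have "continuous_on {t - Q..t + Q} (\<lambda>s. psi (om z s))"
    by (intro continuous_on_compose2[OF coord_cont(3) continuous_on_subset[OF om_cont]]) auto
  moreover have "psi (om z (t - Q)) \<le> t" "t \<le> psi (om z (t + Q))" "0 \<le> Q"
    using coord_close(3)[of "om z (t - Q)"] coord_close(3)[of "om z (t + Q)"] by (auto simp: om)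
  ultimately obtain s where "psi (om z s) = t"
    using IVT'[of "\<lambda>s. psi (om z s)" "t - Q" t "t + Q"] by auto
  then show ?thesis using om by blast
qed

end

text \<open>Turns a rate for tangent vectors into a distance bound for the endpoints of a curve;
  \<open>P\<close> will be an iterate of the lift or of its inverse.\<close>

lemma path_image_bound:
  fixes P :: "real^3 \<Rightarrow> real^3"
  assumes "\<And>t. t \<in> {0..1} \<Longrightarrow> (\<gamma> has_vector_derivative \<gamma>' t) (at t within {0..1})"
    and "\<And>x. P differentiable (at x)"
    and "\<And>t. t \<in> {0..1} \<Longrightarrow> norm (dF P (\<gamma> t) (\<gamma>' t)) \<le> C"
  shows "norm (P (\<gamma> 1) - P (\<gamma> 0)) \<le> C"
proof -
  have der: "((\<lambda>t. P (\<gamma> t)) has_derivative (\<lambda>h. h *\<^sub>R dF P (\<gamma> t) (\<gamma>' t))) (at t within {0..1})"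
    if "t \<in> {0..1}" for t
  proof -
    have "(P \<circ> \<gamma> has_derivative dF P (\<gamma> t) \<circ> (\<lambda>h. h *\<^sub>R \<gamma>' t)) (at t within {0..1})"
    proof (rule diff_chain_within)
      show "(\<gamma> has_derivative (\<lambda>h. h *\<^sub>R \<gamma>' t)) (at t within {0..1})"
        using assms(1)[OF that] by (simp add: has_vector_derivative_def)
      show "(P has_derivative dF P (\<gamma> t)) (at (\<gamma> t) within \<gamma> ` {0..1})"
        using has_derivative_dF[OF assms(2)] has_derivative_at_withinI by blast
    qed
    then show ?thesis
      using linear_dF[OF assms(2)] by (simp add: o_def linear_scale)
  qed
  have "norm (P (\<gamma> 1) - P (\<gamma> 0)) \<le> C * norm (1 - 0 :: real)"
  proof (rule differentiable_bound[OF _ der])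
    show "onorm (\<lambda>h. h *\<^sub>R dF P (\<gamma> t) (\<gamma>' t)) \<le> C" if "t \<in> {0..1}" for t
    proof (rule onorm_le)
      fix h :: real
      show "norm (h *\<^sub>R dF P (\<gamma> t) (\<gamma>' t)) \<le> C * norm h"
        using mult_right_mono[OF assms(3)[OF that] abs_ge_zero[of h]] by (simp add: mult.commute)
    qed
  qed auto
  then show ?thesis by simp
qed

section \<open>Tangent curves of the unstable bundle\<close>

context near_linear
begin

lemma bundle_Gn:
  assumes E_inv: "\<And>x. dF F x ` E x = E (F x)" and "v \<in> E x"
  shows "dF (G ^^ n) x v \<in> E ((G ^^ n) x)"
proof (induction n)
  case 0
  then show ?case using assms by (simp only: dF_funpow_0) simp
next
  case (Suc n)
  define y where "y = (G ^^ n) x"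
  have "E y = dF F (G y) ` E (G y)" using E_inv[of "G y"] by simp
  then obtain v' where v': "v' \<in> E (G y)" "dF (G ^^ n) x v = dF F (G y) v'"
    using Suc y_def by blast
  have "dF G y (dF F (G y) v') = v'" using dF_GF_iter[of 1 "G y" v'] by simp
  then show ?case using v' by (simp add: dF_funpow_Suc[OF G_diff] y_def del: funpow.simps) simp
qed

end

text \<open>The inclusion \<open>E_K\<close> replaces the growth constants of the splitting: inside
  the cone the rate \<open>be\<close> holds with constant 1.\<close>

locale unstable_bundle = near_linear +
  fixes E :: "real^3 \<Rightarrow> (real^3) set"
  assumes E_subspace: "\<And>x. subspace (E x)" and E_dim: "\<And>x. dim (E x) = 1"
    and E_inv: "\<And>x. dF F x ` E x = E (F x)" and E_K: "\<And>x. E x \<subseteq> K"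
begin

lemmas E_Gn = bundle_Gn[of E, OF E_inv]

lemma E_rate:
  assumes "v \<in> E x"
  shows "be ^ n * N (dF (G ^^ n) x v) \<le> N v"
  using backward_cone[of n "\<lambda>n. dF (G ^^ n) x v"] step_dG E_Gn[OF assms, of n] E_K
  by (simp only: dF_funpow_0) blast

lemma E_rate': "v \<in> E x \<Longrightarrow> N (dF (G ^^ n) x v) \<le> N v / be ^ n"
  using E_rate[of v x n] al_be by (simp add: field_simps)

text \<open>Nonzero vectors of \<open>K\<close> have nonzero \<open>a3\<close>, so each line has a
  generator of height 1. This normalization makes \<open>dir\<close> the velocity of
  \<open>om\<close>, which is parametrized by height.\<close>

definition dir where "dir x = (SOME v. v \<in> E x \<and> a3 \<bullet> v = 1)"

lemma dir: "dir x \<in> E x" "a3 \<bullet> dir x = 1" "N (dir x) = 1"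
proof -
  have "E x \<noteq> {0}" "0 \<in> E x" using E_dim[of x] E_subspace[of x] subspace_0 by auto
  then obtain v where v: "v \<in> E x" "v \<noteq> 0" by blast
  then have "a3 \<bullet> v \<noteq> 0" using E_K not_in_K by blast
  then have "(1 / (a3 \<bullet> v)) *\<^sub>R v \<in> E x \<and> a3 \<bullet> ((1 / (a3 \<bullet> v)) *\<^sub>R v) = 1"
    using v(1) E_subspace subspace_scale by auto
  then have "\<exists>v. v \<in> E x \<and> a3 \<bullet> v = 1" by blast
  from someI_ex[OF this] show d: "dir x \<in> E x" "a3 \<bullet> dir x = 1" unfolding dir_def by blast+
  show "N (dir x) = 1" using d N_cone E_K by force
qed

lemma continuous_dG:
  assumes "continuous_on UNIV p" "continuous_on UNIV q"
  shows "continuous_on UNIV (\<lambda>x. dF G (p x) (q x))"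
proof -
  have "dF G (p x) (q x) = (\<Sum>b\<in>Basis. (q x \<bullet> b) *\<^sub>R dF G (p x) b)" for x
  proof -
    have "dF G (p x) (q x) = dF G (p x) (\<Sum>b\<in>Basis. (q x \<bullet> b) *\<^sub>R b)"
      by (simp add: euclidean_representation)
    also have "\<dots> = (\<Sum>b\<in>Basis. (q x \<bullet> b) *\<^sub>R dF G (p x) b)"
      using linear_dF[OF G_diff] by (simp add: linear_sum linear_scale)
    finally show ?thesis .
  qed
  then show ?thesis
    using assms by (auto intro!: continuous_intros continuous_on_compose2[OF G_C1])
qed

lemma continuous_dGn: "continuous_on UNIV (\<lambda>x. dF (G ^^ n) x v)"
proof (induction n)
  case 0
  then show ?case by (simp only: dF_funpow_0) (rule continuous_on_const)
next
  case (Suc n)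
  then show ?case
    by (simp only: dF_funpow_Suc[OF G_diff]) (intro continuous_dG Gn_cont)
qed

lemma al_be_tendsto2: "(\<lambda>n. 2 * (al / be) ^ n) \<longlonglongrightarrow> 0"
  by (rule tendsto_mult_right_zero[OF al_be_tendsto])

text \<open>The infinitesimal form of \<open>om_tendsto\<close>: \<open>dir y - dir x\<close> has
  height 0, so \<open>separation_dF\<close> applies, while both generators contract fast in the
  past. The derivative at \<open>y\<close> acts on \<open>dir x\<close> as well, and continuity in
  the base point handles that term.\<close>

lemma dir_cont: "continuous_on UNIV dir"
  unfolding continuous_on_def
proof
  fix x
  show "(dir \<longlongrightarrow> dir x) (at x)"
    unfolding tendsto_N_iff
  proof (rule tendsto_0_family)
    show "\<forall>\<^sub>F y in at x. N (dir y - dir x) \<le> 2 * (al / be) ^ n +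
        al ^ n * N (dF (G ^^ n) y (dir x) - dF (G ^^ n) x (dir x))" for n
    proof (intro always_eventually allI)
      fix y
      have lin: "dF (G ^^ n) y (dir y - dir x) = dF (G ^^ n) y (dir y) - dF (G ^^ n) y (dir x)"
        using linear_dF[OF funpow_differentiable[OF G_diff]] by (rule linear_diff)
      have "N (dF (G ^^ n) y (dir y - dir x)) \<le> N (dF (G ^^ n) y (dir y)) + N (dF (G ^^ n) y (dir x))"
        "N (dF (G ^^ n) y (dir x)) \<le> N (dF (G ^^ n) y (dir x) - dF (G ^^ n) x (dir x)) + N (dF (G ^^ n) x (dir x))"
        using N_triangle_diff[of "dF (G ^^ n) y (dir y)" "dF (G ^^ n) y (dir x)"] lin
          N_triangle[of "dF (G ^^ n) y (dir x) - dF (G ^^ n) x (dir x)" "dF (G ^^ n) x (dir x)"] by simp_all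
      then have "N (dF (G ^^ n) y (dir y - dir x)) \<le> 2 / be ^ n + N (dF (G ^^ n) y (dir x) - dF (G ^^ n) x (dir x))"
        using E_rate'[OF dir(1), of n x] E_rate'[OF dir(1), of n y] by (simp add: dir)
      then have "al ^ n * N (dF (G ^^ n) y (dir y - dir x)) \<le> al ^ n * (2 / be ^ n + N (dF (G ^^ n) y (dir x) - dF (G ^^ n) x (dir x)))"
        using al_be by (intro mult_left_mono) auto
      moreover have "N (dir y - dir x) \<le> al ^ n * N (dF (G ^^ n) y (dir y - dir x))"
        by (rule separation_dF) (simp add: inner_diff_right dir)
      ultimately show "N (dir y - dir x) \<le> 2 * (al / be) ^ n +
        al ^ n * N (dF (G ^^ n) y (dir x) - dF (G ^^ n) x (dir x))"
        by (simp add: distrib_left power_divide mult.commute)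
    qed
    show "((\<lambda>y. al ^ n * N (dF (G ^^ n) y (dir x) - dF (G ^^ n) x (dir x))) \<longlongrightarrow> 0) (at x)" for n
    proof -
      have "((\<lambda>y. dF (G ^^ n) y (dir x)) \<longlongrightarrow> dF (G ^^ n) x (dir x)) (at x)"
        using continuous_dGn unfolding continuous_on_def by blast
      then show ?thesis unfolding tendsto_N_iff by (rule tendsto_mult_right_zero)
    qed
  qed (rule N_nonneg al_be_tendsto2)+
qed

text \<open>By \<open>separation\<close> it suffices to compare the backward iterates of \<open>om z s\<close> and of its linear
  approximation \<open>p s\<close>. These are within \<open>2 \<bar>s - t\<bar> / be\<^sup>n\<close> of each other up to \<open>o(s - t)\<close>, and
  \<open>al\<^sup>n / be\<^sup>n\<close> tends to zero.\<close>

lemma om_derivative: "(om z has_vector_derivative dir (om z t)) (at t)"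
proof -
  define x where "x = om z t"
  define p where "p s = x + (s - t) *\<^sub>R dir x" for s
  define rho where "rho n s = (G ^^ n) (p s) - (G ^^ n) x - (s - t) *\<^sub>R dF (G ^^ n) x (dir x)" for n s
  have rho: "((\<lambda>s. N (rho n s) / \<bar>s - t\<bar>) \<longlongrightarrow> 0) (at t)" for n
  proof -
    have "((G ^^ n) \<circ> p has_derivative dF (G ^^ n) x \<circ> (\<lambda>h. h *\<^sub>R dir x)) (at t)"
    proof (rule diff_chain_at)
      show "(p has_derivative (\<lambda>h. h *\<^sub>R dir x)) (at t)"
        unfolding p_def by (auto intro!: derivative_eq_intros)
      show "((G ^^ n) has_derivative dF (G ^^ n) x) (at (p t))"
        using has_derivative_dF[OF funpow_differentiable[OF G_diff]] by (simp add: p_def)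
    qed
    moreover have "dF (G ^^ n) x (h *\<^sub>R dir x) = h *\<^sub>R dF (G ^^ n) x (dir x)" for h
      using linear_dF[OF funpow_differentiable[OF G_diff]] by (simp add: linear_scale)
    ultimately have "((\<lambda>s. norm (rho n s) / norm (s - t)) \<longlongrightarrow> 0) (at t)"
      unfolding has_derivative_iff_norm by (simp add: rho_def p_def)
    then have "((\<lambda>s. c * (norm (rho n s) / norm (s - t))) \<longlongrightarrow> 0) (at t)"
      by (rule tendsto_mult_right_zero)
    then show ?thesis
    proof (rule Lim_null_comparison[rotated], intro always_eventually allI)
      fix s
      show "norm (N (rho n s) / \<bar>s - t\<bar>) \<le> c * (norm (rho n s) / norm (s - t))"
        using divide_right_mono[OF c(3)[of "rho n s"] abs_ge_zero[of "s - t"]] by simp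
    qed
  qed
  have "((\<lambda>s. N (om z s - p s) / \<bar>s - t\<bar>) \<longlongrightarrow> 0) (at t)"
  proof (rule tendsto_0_family)
    show "\<forall>\<^sub>F s in at t. N (om z s - p s) / \<bar>s - t\<bar> \<le> 2 * (al / be) ^ n + al ^ n * (N (rho n s) / \<bar>s - t\<bar>)" for n
      unfolding eventually_at_filter
    proof (intro always_eventually allI impI)
      fix s assume s: "s \<noteq> t"
      define q where "q = om z s"
      define D where "D = (s - t) *\<^sub>R dF (G ^^ n) x (dir x)"
      have split: "(G ^^ n) q - (G ^^ n) (p s) = ((G ^^ n) q - (G ^^ n) x) - (D + rho n s)"
        by (simp add: rho_def D_def)
      have "N ((G ^^ n) q - (G ^^ n) (p s)) \<le> N ((G ^^ n) q - (G ^^ n) x) + (N D + N (rho n s))"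
        unfolding split using N_triangle_diff[of "(G ^^ n) q - (G ^^ n) x" "D + rho n s"] N_triangle[of D "rho n s"] by linarith
      moreover have "N ((G ^^ n) q - (G ^^ n) x) \<le> \<bar>s - t\<bar> / be ^ n"
      proof -
        have "q \<in> W x" unfolding q_def x_def using om W_sym W_trans by blast
        then have "be ^ n * N ((G ^^ n) q - (G ^^ n) x) \<le> \<bar>s - t\<bar>"
          using W_rate om_N by (metis q_def x_def)
        then show ?thesis using al_be by (simp add: field_simps)
      qed
      moreover have "N D \<le> \<bar>s - t\<bar> / be ^ n"
        using mult_left_mono[OF E_rate'[OF dir(1), of n x] abs_ge_zero[of "s - t"]]
        by (simp add: D_def N_scaleR dir)
      ultimately have "N ((G ^^ n) q - (G ^^ n) (p s)) \<le> 2 * (\<bar>s - t\<bar> / be ^ n) + N (rho n s)"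
        by simp
      then have "al ^ n * N ((G ^^ n) q - (G ^^ n) (p s)) \<le> al ^ n * (2 * (\<bar>s - t\<bar> / be ^ n) + N (rho n s))"
        using al_be by (intro mult_left_mono) auto
      moreover have "N (q - p s) \<le> al ^ n * N ((G ^^ n) q - (G ^^ n) (p s))"
        by (rule separation) (simp add: q_def p_def om dir x_def inner_diff_right inner_add_right)
      ultimately have "N (q - p s) \<le> al ^ n * (2 * (\<bar>s - t\<bar> / be ^ n) + N (rho n s))" by simp
      then have "N (q - p s) / \<bar>s - t\<bar> \<le> al ^ n * (2 * (\<bar>s - t\<bar> / be ^ n) + N (rho n s)) / \<bar>s - t\<bar>"
        by (rule divide_right_mono) simp
      also have "\<dots> = 2 * (al / be) ^ n + al ^ n * (N (rho n s) / \<bar>s - t\<bar>)"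
        using s by (simp add: power_divide distrib_left add_divide_distrib)
      finally show "N (om z s - p s) / \<bar>s - t\<bar> \<le> 2 * (al / be) ^ n + al ^ n * (N (rho n s) / \<bar>s - t\<bar>)"
        by (simp add: q_def)
    qed
    show "((\<lambda>s. al ^ n * (N (rho n s) / \<bar>s - t\<bar>)) \<longlongrightarrow> 0) (at t)" for n
      by (rule tendsto_mult_right_zero[OF rho])
    show "0 \<le> N (om z s - p s) / \<bar>s - t\<bar>" for s by simp
  qed (rule al_be_tendsto2)
  then have "((\<lambda>s. c * (N (om z s - p s) / \<bar>s - t\<bar>)) \<longlongrightarrow> 0) (at t)"
    by (rule tendsto_mult_right_zero)
  then have "((\<lambda>s. norm (om z s - p s) / \<bar>s - t\<bar>) \<longlongrightarrow> 0) (at t)"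
  proof (rule Lim_null_comparison[rotated], intro always_eventually allI)
    fix s
    show "norm (norm (om z s - p s) / \<bar>s - t\<bar>) \<le> c * (N (om z s - p s) / \<bar>s - t\<bar>)"
      using divide_right_mono[OF c(2)[of "om z s - p s"] abs_ge_zero[of "s - t"]] by simp
  qed
  moreover have "bounded_linear (\<lambda>h. h *\<^sub>R dir x)" by (rule bounded_linear_scaleR_left)
  ultimately have "(om z has_derivative (\<lambda>h. h *\<^sub>R dir x)) (at t)"
    unfolding has_derivative_iff_norm by (simp add: p_def x_def algebra_simps)
  then show ?thesis by (simp add: has_vector_derivative_def x_def)
qed

text \<open>Integrating the contraction of tangent vectors along the curve shows that the endpoints
  approach at rate \<open>be\<close> in the past; the constant depends on the speed bound
  \<open>L\<close> of the curve.\<close>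

lemma leaf_subset_W: "leaf E z \<subseteq> W z"
proof
  fix z'
  assume "z' \<in> leaf E z"
  then obtain \<gamma> \<gamma>' where \<gamma>: "\<gamma> 0 = z" "\<gamma> 1 = z'" "continuous_on {0..1} \<gamma>'"
    "\<And>t. t \<in> {0..1} \<Longrightarrow> (\<gamma> has_vector_derivative \<gamma>' t) (at t within {0..1})"
    "\<And>t. t \<in> {0..1::real} \<Longrightarrow> \<gamma>' t \<in> E (\<gamma> t)"
    unfolding leaf_def by blast
  have "bounded (\<gamma>' ` {0..1})"
    using compact_continuous_image[OF \<gamma>(3)] compact_imp_bounded by blast
  then obtain L where L: "\<And>t. t \<in> {0..1} \<Longrightarrow> norm (\<gamma>' t) \<le> L"
    unfolding bounded_iff by blast
  show "z' \<in> W z"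
  proof (rule W_I)
    fix n
    have "norm ((G ^^ n) (\<gamma> 1) - (G ^^ n) (\<gamma> 0)) \<le> c * (c * L / be ^ n)"
    proof (rule path_image_bound[OF \<gamma>(4) funpow_differentiable[OF G_diff]])
      fix t :: real
      assume t: "t \<in> {0..1}"
      have "N (dF (G ^^ n) (\<gamma> t) (\<gamma>' t)) \<le> N (\<gamma>' t) / be ^ n" by (rule E_rate'[OF \<gamma>(5)[OF t]])
      also have "\<dots> \<le> c * L / be ^ n"
      proof (rule divide_right_mono)
        show "N (\<gamma>' t) \<le> c * L"
          using c(3)[of "\<gamma>' t"] mult_left_mono[OF L[OF t], of c] c(1) by linarith
      qed (use al_be in simp)
      finally have "c * N (dF (G ^^ n) (\<gamma> t) (\<gamma>' t)) \<le> c * (c * L / be ^ n)"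
        using c(1) by (intro mult_left_mono) auto
      with c(2) show "norm (dF (G ^^ n) (\<gamma> t) (\<gamma>' t)) \<le> c * (c * L / be ^ n)"
        by (rule order_trans)
    qed
    then have "c * norm ((G ^^ n) z' - (G ^^ n) z) \<le> c * (c * (c * L / be ^ n))"
      unfolding \<gamma> using c(1) by (intro mult_left_mono) auto
    with c(3) have "N ((G ^^ n) z' - (G ^^ n) z) \<le> c * (c * (c * L / be ^ n))"
      by (rule order_trans)
    then have "be ^ n * N ((G ^^ n) z' - (G ^^ n) z) \<le> be ^ n * (c * (c * (c * L / be ^ n)))"
      using al_be by (intro mult_left_mono) auto
    also have "\<dots> = c * (c * (c * L))" using al_be by simp
    finally show "be ^ n * N ((G ^^ n) z' - (G ^^ n) z) \<le> c * (c * (c * L))" .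
  qed
qed

text \<open>The curve \<open>om z\<close>, traversed affinely in height, joins the two points and is
  tangent to the bundle by \<open>om_derivative\<close>.\<close>

lemma W_subset_leaf: "W z \<subseteq> leaf E z"
proof
  fix z'
  assume z': "z' \<in> W z"
  define d where "d = a3 \<bullet> z' - a3 \<bullet> z"
  define h where "h \<tau> = a3 \<bullet> z + \<tau> * d" for \<tau>
  have hc: "continuous_on {0..1} h" unfolding h_def by (intro continuous_intros)
  have cont: "continuous_on {0..1} (\<lambda>\<tau>. d *\<^sub>R dir (om z (h \<tau>)))"
    by (intro continuous_intros continuous_on_compose2[OF dir_cont] continuous_on_compose2[OF om_cont] hc) auto
  have der: "((\<lambda>\<tau>. om z (h \<tau>)) has_vector_derivative d *\<^sub>R dir (om z (h t))) (at t within {0..1})" for t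
  proof -
    have "(om z \<circ> h has_vector_derivative d *\<^sub>R dir (om z (h t))) (at t within {0..1})"
    proof (rule vector_diff_chain_within)
      show "(h has_vector_derivative d) (at t within {0..1})"
        unfolding h_def by (auto intro!: derivative_eq_intros)
      show "(om z has_vector_derivative dir (om z (h t))) (at (h t) within h ` {0..1})"
        using om_derivative has_vector_derivative_at_within by blast
    qed
    then show ?thesis by (simp add: o_def)
  qed
  have "om z (h 0) = z" "om z (h 1) = z'"
    using om_eqI[OF W_refl] om_eqI[OF z'] by (simp_all add: h_def d_def)
  moreover have "d *\<^sub>R dir (om z (h \<tau>)) \<in> E (om z (h \<tau>))" for \<tau>
    using dir(1) E_subspace subspace_scale by blast
  ultimately show "z' \<in> leaf E z"
    unfolding leaf_def using cont der
    by (intro CollectI exI[of _ "\<lambda>\<tau>. om z (h \<tau>)"] exI[of _ "\<lambda>\<tau>. d *\<^sub>R dir (om z (h \<tau>))"]) auto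
qed

lemma leaf_eq_W: "leaf E z = W z"
  using leaf_subset_W W_subset_leaf by blast

end

subsection \<open>The strong unstable bundle lies in the cone\<close>

lemma one_dimensional_multiple:
  assumes "subspace S" "dim S = 1" "b \<in> S" "b \<noteq> 0" "v \<in> S"
  shows "\<exists>r. v = r *\<^sub>R (b :: real^3)"
proof -
  have "span {b} = S"
    by (rule subspace_dim_equal) (use assms in \<open>auto simp: span_minimal\<close>)
  then show ?thesis using assms(5) span_singleton by auto
qed

lemma geometric_gap:
  fixes p q r :: real
  assumes "0 < p" "p < q"
  shows "\<exists>n>0. r * p ^ n < q ^ n"
proof -
  have "(\<lambda>n. r * (p / q) ^ n) \<longlonglongrightarrow> r * 0"
    using assms by (intro tendsto_intros LIMSEQ_power_zero) auto
  then have "\<forall>\<^sub>F n in sequentially. r * (p / q) ^ n < 1"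
    by (intro order_tendstoD(2)) auto
  then obtain n where "n > 0" "r * (p / q) ^ n < 1"
    using eventually_gt_at_top[of 0] eventually_happens'[OF _ eventually_conj] by (metis (mono_tags) sequentially_bot)
  then have "n > 0 \<and> r * p ^ n < q ^ n"
    using assms by (simp add: power_divide field_simps)
  then show ?thesis by blast
qed

lemma ph_splitting_rates:
  assumes "ph_splitting F Es Ec Eu"
  obtains C lam gh g mu where "C \<ge> 1" "0 < lam" "lam < gh" "gh < 1" "1 < g" "g < mu"
    "\<And>x n v. v \<in> Es x \<Longrightarrow> norm (dF (F ^^ n) x v) \<le> C * lam ^ n * norm v"
    "\<And>x n v. v \<in> Ec x \<Longrightarrow> inverse C * gh ^ n * norm v \<le> norm (dF (F ^^ n) x v)"
    "\<And>x n v. v \<in> Ec x \<Longrightarrow> norm (dF (F ^^ n) x v) \<le> C * g ^ n * norm v"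
    "\<And>x n v. v \<in> Eu x \<Longrightarrow> inverse C * mu ^ n * norm v \<le> norm (dF (F ^^ n) x v)"
proof -
  obtain C lam gh g mu where *: "C \<ge> 1 \<and> 0 < lam \<and> lam < gh \<and> gh < 1 \<and> 1 < g \<and> g < mu \<and>
        (\<forall>x n. (\<forall>v\<in>Es x. norm (dF (F ^^ n) x v) \<le> C * lam ^ n * norm v) \<and>
               (\<forall>v\<in>Ec x. inverse C * gh ^ n * norm v \<le> norm (dF (F ^^ n) x v) \<and>
                          norm (dF (F ^^ n) x v) \<le> C * g ^ n * norm v) \<and>
               (\<forall>v\<in>Eu x. inverse C * mu ^ n * norm v \<le> norm (dF (F ^^ n) x v)))"
    using assms[unfolded ph_splitting_def, THEN conjunct2, THEN conjunct2] by (elim exE) (rule that)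
  then show ?thesis by (intro that[of C lam gh g mu]) blast+
qed

context near_linear
begin

lemma N_A: "N (A *v x) \<le> l3 * N x"
proof -
  have "\<bar>l * y\<bar> \<le> l3 * N x" if "0 \<le> l" "l \<le> l3" "\<bar>y\<bar> \<le> N x" for l y
  proof -
    have "l * \<bar>y\<bar> \<le> l3 * N x" using that by (intro mult_mono) auto
    then show ?thesis using that by (simp add: abs_mult)
  qed
  then show ?thesis
    using ls coord_le_N[of x] N_def[of "A *v x"] by (simp add: eigen)
qed

lemma step_upper:
  assumes "step a b"
  shows "N b \<le> (l3 + \<delta>) * N a"
proof -
  have "N b \<le> N (b - A *v a) + N (A *v a)"
    using N_triangle[of "b - A *v a" "A *v a"] by simp
  then show ?thesis using assms N_A[of a] unfolding step_def by (simp add: distrib_right)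
qed

lemma dFn_bound: "N (dF (F ^^ n) x v) \<le> (l3 + \<delta>) ^ n * N v"
proof (induction n)
  case 0
  then show ?case by (simp only: dF_funpow_0) simp
next
  case (Suc n)
  have "(l3 + \<delta>) * N (dF (F ^^ n) x v) \<le> (l3 + \<delta>) * ((l3 + \<delta>) ^ n * N v)"
    using Suc ls by (intro mult_left_mono) auto
  then show ?case
    using step_upper[OF step_dF_iter[of n x v]] by (simp add: mult.assoc del: funpow.simps)
qed

lemma dFn_norm_bound: "norm (dF (F ^^ n) x v) \<le> c * ((l3 + \<delta>) ^ n * (c * norm v))"
proof -
  have "(l3 + \<delta>) ^ n * N v \<le> (l3 + \<delta>) ^ n * (c * norm v)"
    using ls by (intro mult_left_mono c(3)) auto
  then have "N (dF (F ^^ n) x v) \<le> (l3 + \<delta>) ^ n * (c * norm v)"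
    using dFn_bound[of n x v] by linarith
  then have "c * N (dF (F ^^ n) x v) \<le> c * ((l3 + \<delta>) ^ n * (c * norm v))"
    using c(1) by (intro mult_left_mono) auto
  with c(2) show ?thesis by (rule order_trans)
qed

lemma dFn_add: "dF (F ^^ n) x (v + w) = dF (F ^^ n) x v + dF (F ^^ n) x w"
  using linear_dF[OF funpow_differentiable[OF F_diff]] linear_add by blast

text \<open>The bundles are not known to be continuous, so the angle bound comes from the rates. For
  one fixed \<open>n\<close> the faster bundle beats the slower one despite the constants; if
  \<open>a + b\<close> were tiny compared with \<open>a\<close>, the images of \<open>a\<close> and
  \<open>b\<close> would nearly cancel although their lengths differ.\<close>

lemma domination_angle:
  assumes "0 < p" "p < q" "0 < C" "0 < D"
    and S: "\<And>x n v. v \<in> S x \<Longrightarrow> norm (dF (F ^^ n) x v) \<le> C * p ^ n * norm v"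
    and T: "\<And>x n v. v \<in> T x \<Longrightarrow> D * q ^ n * norm v \<le> norm (dF (F ^^ n) x v)"
  obtains k where "0 \<le> k" "\<And>x a b. a \<in> S x \<Longrightarrow> b \<in> T x \<Longrightarrow> norm a \<le> k * norm (a + b)"
proof -
  obtain n where "C / D * p ^ n < q ^ n" using geometric_gap[OF assms(1,2)] by blast
  then have gap: "C * p ^ n < D * q ^ n" using assms by (simp add: field_simps)
  define M where "M = c * ((l3 + \<delta>) ^ n * c)"
  have M: "0 \<le> M" using c(1) ls by (simp add: M_def)
  define k where "k = (M + D * q ^ n) / (D * q ^ n - C * p ^ n)"
  have k: "0 \<le> k" unfolding k_def using M gap assms by (intro divide_nonneg_nonneg add_nonneg_nonneg) auto
  moreover have "norm a \<le> k * norm (a + b)" if "a \<in> S x" "b \<in> T x" for x a b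
  proof -
    have "D * q ^ n * norm b \<le> norm (dF (F ^^ n) x b)" by (rule T[OF that(2)])
    also have "dF (F ^^ n) x b = dF (F ^^ n) x (a + b) - dF (F ^^ n) x a" by (simp add: dFn_add)
    also have "norm \<dots> \<le> norm (dF (F ^^ n) x (a + b)) + norm (dF (F ^^ n) x a)"
      by (rule norm_triangle_ineq4)
    also have "\<dots> \<le> M * norm (a + b) + C * p ^ n * norm a"
      using dFn_norm_bound[of n x "a + b"] S[OF that(1), of n] by (simp add: M_def mult.assoc)
    finally have 1: "D * q ^ n * norm b \<le> M * norm (a + b) + C * p ^ n * norm a" .
    have "norm a \<le> norm (a + b) + norm b" using norm_triangle_ineq4[of "a + b" b] by simp
    then have "D * q ^ n * norm a \<le> D * q ^ n * (norm (a + b) + norm b)"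
      using assms by (intro mult_left_mono) auto
    then have "(D * q ^ n - C * p ^ n) * norm a \<le> (M + D * q ^ n) * norm (a + b)"
      using 1 by (simp add: algebra_simps)
    then show ?thesis using gap by (simp add: k_def field_simps)
  qed
  ultimately show ?thesis using that by blast
qed

lemma m_diff: "m (x - y) \<le> m x + N y"
proof -
  have "\<bar>a1 \<bullet> (x - y)\<bar> \<le> \<bar>a1 \<bullet> x\<bar> + \<bar>a1 \<bullet> y\<bar>" "\<bar>a2 \<bullet> (x - y)\<bar> \<le> \<bar>a2 \<bullet> x\<bar> + \<bar>a2 \<bullet> y\<bar>"
    by (simp_all add: inner_diff_right)
  moreover have "\<bar>a1 \<bullet> x\<bar> \<le> m x" "\<bar>a2 \<bullet> x\<bar> \<le> m x" by (simp_all add: m_def)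
  ultimately have "\<bar>a1 \<bullet> (x - y)\<bar> \<le> m x + N y" "\<bar>a2 \<bullet> (x - y)\<bar> \<le> m x + N y"
    using coord_le_N[of y] by linarith+
  then show ?thesis by (simp add: m_def)
qed

text \<open>If the strong unstable rate exceeds \<^term>\<open>al\<close>, a vector outside \<^term>\<open>K\<close> is contracted too
  slowly in the past to be unstable. Otherwise the center rate is below \<^term>\<open>be\<close>, so
  the center-stable part of \<^term>\<open>v3\<close> becomes negligible in the future, and the unstable part
  follows \<^term>\<open>v3\<close> into \<^term>\<open>K\<close>.\<close>

lemma unstable_in_cone:
  assumes "ph_splitting F Es Ec Eu"
  shows "Eu x \<subseteq> K"
proof -
  have Eu: "subspace (Eu x)" "dim (Eu x) = 1" "dF F x ` Eu x = Eu (F x)" for x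
    using assms unfolding ph_splitting_def by blast+
  have span: "{a + b + c | a b c. a \<in> Es x \<and> b \<in> Ec x \<and> c \<in> Eu x} = UNIV" for x
    using assms unfolding ph_splitting_def by blast
  obtain C lam gh g mu where r: "C \<ge> 1" "0 < lam" "lam < gh" "gh < 1" "1 < g" "g < mu"
    and Es_g: "\<And>x n v. v \<in> Es x \<Longrightarrow> norm (dF (F ^^ n) x v) \<le> C * lam ^ n * norm v"
    and Ec_l: "\<And>x n v. v \<in> Ec x \<Longrightarrow> inverse C * gh ^ n * norm v \<le> norm (dF (F ^^ n) x v)"
    and Ec_u: "\<And>x n v. v \<in> Ec x \<Longrightarrow> norm (dF (F ^^ n) x v) \<le> C * g ^ n * norm v"
    and Eu_g: "\<And>x n v. v \<in> Eu x \<Longrightarrow> inverse C * mu ^ n * norm v \<le> norm (dF (F ^^ n) x v)"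
    by (rule ph_splitting_rates[OF assms]) (rule that; blast)
  show ?thesis
  proof (cases "al < mu")
    case True
    show ?thesis
    proof (rule subsetI, rule ccontr)
      fix v assume v: "v \<in> Eu x" "v \<notin> K"
      have le: "m v \<le> (al / mu) ^ n * (c * (C * norm v))" for n
      proof -
        define w where "w = dF (G ^^ n) x v"
        have "w \<in> Eu ((G ^^ n) x)" unfolding w_def by (rule bundle_Gn[of Eu, OF Eu(3) v(1)])
        then have "inverse C * mu ^ n * norm w \<le> norm v"
          using Eu_g[of w _ n] dF_FG_iter[of n x v] by (metis w_def)
        then have "norm w \<le> C * norm v / mu ^ n" using r by (simp add: field_simps)
        then have "c * norm w \<le> c * (C * norm v / mu ^ n)" using c(1) by (intro mult_left_mono) auto
        then have "N w \<le> c * (C * norm v / mu ^ n)" using c(3) order_trans by blast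
        then have "al ^ n * N w \<le> al ^ n * (c * (C * norm v / mu ^ n))"
          using al_be by (intro mult_left_mono) auto
        moreover have "m v \<le> al ^ n * N w"
          using backward_not_cone(2)[of "\<lambda>n. dF (G ^^ n) x v" n] step_dG v(2) dF_funpow_0
          by (simp add: w_def del: funpow.simps)
        ultimately show ?thesis by (simp add: power_divide)
      qed
      have "(\<lambda>n. (al / mu) ^ n * (c * (C * norm v))) \<longlonglongrightarrow> 0 * (c * (C * norm v))"
        using True al_be by (intro tendsto_intros LIMSEQ_power_zero) auto
      then have "m v \<le> 0" using le by (intro LIMSEQ_le_const) auto
      then have "v \<in> K" by (simp add: K_def)
      with v(2) show False by simp
    qed
  next
    case False
    then have gbe: "g < be" using r al_be by linarith
    \<comment> \<open>The angle bound is used twice: here for stable against center, so that their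
      sum grows at most at the center rate, and then for this sum against the unstable
      bundle.\<close>
    obtain k1 where k1: "0 \<le> k1" "\<And>x a b. a \<in> Es x \<Longrightarrow> b \<in> Ec x \<Longrightarrow> norm a \<le> k1 * norm (a + b)"
      using domination_angle[OF r(2,3) _ _ Es_g Ec_l] r(1) by auto
    define S where "S x = {a + b | a b. a \<in> Es x \<and> b \<in> Ec x}" for x
    define P where "P = C * k1 + C * (1 + k1)"
    have P: "0 < P" using r k1 by (simp add: P_def add_nonneg_pos)
    have S_g: "norm (dF (F ^^ n) x v) \<le> P * g ^ n * norm v" if v: "v \<in> S x" for x n v
    proof -
      obtain a b where ab: "a \<in> Es x" "b \<in> Ec x" "v = a + b" using v unfolding S_def by blast
      have a: "norm a \<le> k1 * norm v" using k1(2) ab by blast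
      have b: "norm b \<le> (1 + k1) * norm v"
        using norm_triangle_ineq4[of v a] a ab(3) by (simp add: distrib_right)
      have "lam ^ n \<le> g ^ n" using r by (intro power_mono) auto
      then have "C * lam ^ n * norm a \<le> C * g ^ n * (k1 * norm v)"
        using r a k1(1) by (intro mult_mono) auto
      moreover have "C * g ^ n * norm b \<le> C * g ^ n * ((1 + k1) * norm v)"
        using r b by (intro mult_left_mono) auto
      moreover have "norm (dF (F ^^ n) x v) \<le> norm (dF (F ^^ n) x a) + norm (dF (F ^^ n) x b)"
        unfolding ab(3) dFn_add[of n x a b] by (rule norm_triangle_ineq)
      ultimately have "norm (dF (F ^^ n) x v) \<le> C * g ^ n * (k1 * norm v) + C * g ^ n * ((1 + k1) * norm v)"
        using Es_g[OF ab(1), of n] Ec_u[OF ab(2), of n] by linarith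
      then show ?thesis by (simp add: P_def algebra_simps)
    qed
    obtain k2 where k2: "0 \<le> k2" "\<And>x a b. a \<in> S x \<Longrightarrow> b \<in> Eu x \<Longrightarrow> norm a \<le> k2 * norm (a + b)"
      using domination_angle[OF _ r(6) P _ S_g Eu_g] r by auto
    define R where "R = c * (P * (k2 * norm v3))"
    have R: "0 \<le> R" using c(1) P k2(1) by (simp add: R_def)
    \<comment> \<open>The error \<open>R * g ^ n\<close> enters once in the coordinate
      \<open>a3\<close> and once in \<open>m\<close>; the margin \<open>1 - al / be\<close> of the
      strict cone has to pay for both.\<close>
    obtain n where n: "n > 0" "2 * R / (1 - al / be) * g ^ n < be ^ n"
      using geometric_gap[OF _ gbe, of "2 * R / (1 - al / be)"] r by (metis order.strict_trans zero_less_one)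
    have pos: "0 < 1 - al / be" using al_be by simp
    have gap: "2 * (R * g ^ n) < (1 - al / be) * be ^ n"
      using n(2) pos by (simp add: field_simps)
    define y where "y = (G ^^ n) x"
    obtain a b e where abe: "v3 = a + b + e" "a \<in> Es y" "b \<in> Ec y" "e \<in> Eu y"
      using span[of y] by blast
    define d where "d = a + b"
    have dS: "d \<in> S y" using abe unfolding S_def d_def by blast
    have "norm d \<le> k2 * norm v3" using k2(2)[OF dS abe(4)] abe(1) d_def by simp
    then have "P * g ^ n * norm d \<le> P * g ^ n * (k2 * norm v3)" using P r by (intro mult_left_mono) auto
    then have "norm (dF (F ^^ n) y d) \<le> P * g ^ n * (k2 * norm v3)" using S_g[OF dS, of n] by linarith
    then have "c * norm (dF (F ^^ n) y d) \<le> c * (P * g ^ n * (k2 * norm v3))"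
      using c(1) by (intro mult_left_mono) auto
    then have Nd: "N (dF (F ^^ n) y d) \<le> R * g ^ n"
      using c(3)[of "dF (F ^^ n) y d"] by (simp add: R_def algebra_simps)
    define h where "h i = dF (F ^^ i) y v3" for i
    have st: "step (h i) (h (Suc i))" for i unfolding h_def by (rule step_dF_iter)
    have h0: "h 0 = v3" by (simp add: h_def dF_funpow_0 del: funpow.simps)
    have hK: "h i \<in> K" and hgr: "be ^ i * \<bar>a3 \<bullet> h 0\<bar> \<le> \<bar>a3 \<bullet> h i\<bar>" for i
      using chain_cone[of i h] st h0 v3_in_K[of 1] by auto
    have "be ^ n \<le> \<bar>a3 \<bullet> h n\<bar>" using hgr[of n] by (simp add: h0 v3)
    \<comment> \<open>The strict cone estimate holds for images of a step, which is why
      \<open>n > 0\<close> was required.\<close>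
    have "m (h n) * be \<le> al * \<bar>a3 \<bullet> h n\<bar>"
      using step_cone_strict(1)[OF st hK, of "n - 1"] n(1) by simp
    then have mh: "m (h n) \<le> al / be * \<bar>a3 \<bullet> h n\<bar>" using al_be by (simp add: field_simps)
    define e' where "e' = dF (F ^^ n) y e"
    have e': "e' = h n - dF (F ^^ n) y d"
      using dFn_add[of n y d e] abe(1) by (simp add: e'_def h_def d_def)
    have "(1 - al / be) * be ^ n \<le> (1 - al / be) * \<bar>a3 \<bullet> h n\<bar>"
      using pos \<open>be ^ n \<le> \<bar>a3 \<bullet> h n\<bar>\<close> by (intro mult_left_mono) auto
    then have key: "2 * (R * g ^ n) < \<bar>a3 \<bullet> h n\<bar> - al / be * \<bar>a3 \<bullet> h n\<bar>"
      using gap by (simp add: algebra_simps)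
    have "\<bar>a3 \<bullet> h n\<bar> - R * g ^ n \<le> \<bar>a3 \<bullet> e'\<bar>"
      using Nd coord_le_N(3)[of "dF (F ^^ n) y d"] by (simp add: e' inner_diff_right)
    moreover have "m e' \<le> al / be * \<bar>a3 \<bullet> h n\<bar> + R * g ^ n"
      using m_diff[of "h n" "dF (F ^^ n) y d"] mh Nd e' by simp
    moreover have "0 \<le> al / be * \<bar>a3 \<bullet> h n\<bar>" "0 \<le> R * g ^ n" using al_be R r by simp_all
    ultimately have "m e' \<le> \<bar>a3 \<bullet> e'\<bar>" "0 < \<bar>a3 \<bullet> e'\<bar>" using key by linarith+
    then have eK: "e' \<in> K" "e' \<noteq> 0" by (auto simp: K_def)
    have iter: "dF (F ^^ i) z ` Eu z = Eu ((F ^^ i) z)" for i z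
    proof (induction i)
      case 0
      have *: "dF (F ^^ 0) z = (\<lambda>v. v)" using dF_funpow_0 by blast
      show ?case unfolding * by simp
    next
      case (Suc i)
      have *: "dF (F ^^ Suc i) z = dF F ((F ^^ i) z) \<circ> dF (F ^^ i) z"
        by (rule ext) (simp only: dF_funpow_Suc[OF F_diff] comp_apply)
      show ?case unfolding * image_comp[symmetric] Suc by (simp add: Eu(3))
    qed
    have "e' \<in> dF (F ^^ n) y ` Eu y" unfolding e'_def using abe(4) by (rule imageI)
    then have "e' \<in> Eu x" unfolding iter by (simp add: y_def)
    then show ?thesis
      using one_dimensional_multiple[OF Eu(1,2) _ eK(2)] K_scaleR[OF eK(1)] by blast
  qed
qed


subsection \<open>Rigidity of the center coordinate\<close>

lemma coords_surj: "\<exists>x. a1 \<bullet> x = r1 \<and> a2 \<bullet> x = r2 \<and> a3 \<bullet> x = r3"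
proof -
  define T where "T x = (vector [a1 \<bullet> x, a2 \<bullet> x, a3 \<bullet> x] :: real^3)" for x
  have "linear T"
    by (rule linearI) (simp_all add: T_def vec_eq_iff forall_3 vector_3 inner_add_right)
  moreover have "inj T"
  proof (rule injI)
    fix x y
    assume "T x = T y"
    then have "N (x - y) = 0"
      by (simp add: T_def vec_eq_iff forall_3 vector_3 N_def inner_diff_right)
    then show "x = y" using N_eq_0 by simp
  qed
  ultimately have "surj T" by (rule linear_injective_imp_surjective) simp
  then obtain x where "T x = vector [r1, r2, r3]" by (metis surjD)
  then have "a1 \<bullet> x = r1 \<and> a2 \<bullet> x = r2 \<and> a3 \<bullet> x = r3"
    by (simp add: T_def vec_eq_iff forall_3 vector_3)
  then show ?thesis by blast
qed

lemma lat_translate_cbox: "\<exists>k\<in>lat. x + k \<in> cbox 0 (1 :: real^3)"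
proof
  show "(\<chi> i. - of_int \<lfloor>x $ i\<rfloor>) \<in> lat" by (simp add: lat_def)
  show "x + (\<chi> i. - of_int \<lfloor>x $ i\<rfloor>) \<in> cbox 0 1"
    unfolding mem_box_cart by (simp, linarith)
qed

text \<open>Backward iteration divides the oscillation of \<^term>\<open>phi\<close> along a leaf by \<^term>\<open>l2\<close>.\<close>

lemma constant_leaf_exists:
  assumes osc: "\<And>z. z \<in> W y \<Longrightarrow> \<bar>phi z - phi y\<bar> \<le> M"
  shows "\<exists>y0. \<forall>z\<in>W y0. phi z = phi y0"
proof -
  \<comment> \<open>Integer translations change \<open>phi\<close> by constants. The backward orbit
    of \<open>y\<close> can thus be moved into the unit cube, where it has limit points, without
    affecting oscillations along leaves.\<close>
  obtain k where k: "\<And>n. k n \<in> lat" "\<And>n. (G ^^ n) y + k n \<in> cbox 0 1"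
    using lat_translate_cbox[of "(G ^^ _) y"] by metis
  define X where "X n = (G ^^ n) y + k n" for n
  have dec: "\<bar>phi p - phi (X n)\<bar> \<le> M / l2 ^ n" if p: "p \<in> W (X n)" for p n
  proof -
    have "p + - k n \<in> W (X n + - k n)" by (rule W_lat[OF lat_minus[OF k(1)] p])
    then have "(F ^^ n) (p - k n) \<in> W ((F ^^ n) ((G ^^ n) y))"
      by (intro W_Fn) (simp add: X_def)
    then have "\<bar>phi ((F ^^ n) (p - k n)) - phi ((F ^^ n) ((G ^^ n) y))\<bar> \<le> M"
      using osc by simp
    then have "\<bar>l2 ^ n * (phi (p - k n) - phi ((G ^^ n) y))\<bar> \<le> M"
      by (simp only: coord_conj right_diff_distrib)
    moreover have "phi p - phi (X n) = phi (p - k n) - phi ((G ^^ n) y)"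
      using coord_lat(2)[OF k(1), of "p - k n" n] coord_lat(2)[OF k(1), of "(G ^^ n) y" n] by (simp add: X_def)
    ultimately have "l2 ^ n * \<bar>phi p - phi (X n)\<bar> \<le> M" using ls by (simp add: abs_mult)
    then show ?thesis using ls by (simp add: pos_le_divide_eq mult.commute)
  qed
  obtain y0 r where r: "strict_mono r" "(X \<circ> r) \<longlonglongrightarrow> y0"
    using compact_cbox k(2) unfolding compact_def X_def by (metis (no_types, lifting))
  have "phi z = phi y0" if z: "z \<in> W y0" for z
  proof -
    define t where "t = a3 \<bullet> z"
    have cont: "isCont phi x" for x using coord_cont(2) continuous_on_eq_continuous_at by blast
    have "(\<lambda>i. om ((X \<circ> r) i) t) \<longlonglongrightarrow> z"
      using om_tendsto[OF r(2), of t] om_eqI[OF z] by (simp add: t_def)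
    then have "(\<lambda>i. phi (om ((X \<circ> r) i) t)) \<longlonglongrightarrow> phi z" by (rule isCont_tendsto_compose[OF cont])
    moreover have "(\<lambda>i. phi ((X \<circ> r) i)) \<longlonglongrightarrow> phi y0" by (rule isCont_tendsto_compose[OF cont r(2)])
    ultimately have "(\<lambda>i. phi (om ((X \<circ> r) i) t) - phi ((X \<circ> r) i)) \<longlonglongrightarrow> phi z - phi y0"
      by (rule tendsto_diff)
    moreover have "(\<lambda>i. phi (om ((X \<circ> r) i) t) - phi ((X \<circ> r) i)) \<longlonglongrightarrow> 0"
    proof (rule Lim_null_comparison)
      show "\<forall>\<^sub>F i in sequentially. norm (phi (om ((X \<circ> r) i) t) - phi ((X \<circ> r) i)) \<le> M * (1 / l2) ^ r i"
        using dec[OF om(1)] by (simp add: power_divide)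
      have "(\<lambda>n. M * (1 / l2) ^ n) \<longlonglongrightarrow> 0"
        using ls by (intro tendsto_mult_right_zero LIMSEQ_power_zero) auto
      then show "(\<lambda>i. M * (1 / l2) ^ r i) \<longlonglongrightarrow> 0"
        using LIMSEQ_subseq_LIMSEQ[OF _ r(1)] by (fastforce simp: o_def)
    qed
    ultimately show ?thesis using LIMSEQ_unique by fastforce
  qed
  then show ?thesis by blast
qed

text \<open>The coordinates \<^term>\<open>(sig, phi, psi)\<close> map a leaf with constant \<^term>\<open>phi\<close> onto a line parallel
  to \<^term>\<open>v3\<close>, which is dense modulo \<^term>\<open>lat\<close>; so its lattice translates are dense.\<close>

lemma all_leaves_constant:
  assumes y0: "\<And>z. z \<in> W y0 \<Longrightarrow> phi z = phi y0" and z': "z' \<in> W z"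
  shows "phi z' = phi z"
proof -
  \<comment> \<open>The displacement from \<open>y0\<close> to \<open>z\<close> in linearizing
    coordinates; it is then approximated by a multiple of \<open>v3\<close> modulo
    \<open>lat\<close>.\<close>
  obtain x where x: "a1 \<bullet> x = sig z - sig y0" "a2 \<bullet> x = phi z - phi y0" "a3 \<bullet> x = psi z - psi y0"
    using coords_surj by blast
  obtain t k where tk: "\<And>n. k n \<in> lat" "\<And>n. norm (x - t n *\<^sub>R v3 - k n) < inverse (real (Suc n))"
    using dense[of "inverse (real (Suc _))" x] by (metis inverse_positive_iff_positive of_nat_0_less_iff zero_less_Suc)
  \<comment> \<open>Moving along the leaf of \<open>y0\<close> changes \<open>psi\<close> only, and
    the translation by \<open>k n\<close> supplies the rest, so \<open>p n\<close> approaches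
    \<open>z\<close> in all three coordinates.\<close>
  have "\<forall>n. \<exists>q. q \<in> W y0 \<and> psi q = psi y0 + t n" using psi_W_surj by blast
  then obtain Y where Y: "\<And>n. Y n \<in> W y0" "\<And>n. psi (Y n) = psi y0 + t n"
    by metis
  define p where "p n = Y n + k n" for n
  define \<epsilon> where "\<epsilon> n = x - t n *\<^sub>R v3 - k n" for n
  have eps: "\<epsilon> \<longlonglongrightarrow> 0"
  proof (rule Lim_null_comparison[OF _ LIMSEQ_inverse_real_of_nat])
    show "\<forall>\<^sub>F n in sequentially. norm (\<epsilon> n) \<le> inverse (real (Suc n))"
      using tk(2) unfolding \<epsilon>_def by (intro always_eventually allI less_imp_le)
  qed
  have pc: "sig (p n) = sig z - a1 \<bullet> \<epsilon> n" "phi (p n) = phi z - a2 \<bullet> \<epsilon> n" "psi (p n) = psi z - a3 \<bullet> \<epsilon> n" for n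
    using coord_lat[OF tk(1), of "Y n" n] sig_W[OF Y(1)] y0[OF Y(1)] Y(2)[of n] x
    by (simp_all add: p_def \<epsilon>_def inner_diff_right v3)
  have lim: "(\<lambda>n. sig (p n)) \<longlonglongrightarrow> sig z" "(\<lambda>n. phi (p n)) \<longlonglongrightarrow> phi z" "(\<lambda>n. psi (p n)) \<longlonglongrightarrow> psi z"
  proof -
    have "(\<lambda>n. r - a \<bullet> \<epsilon> n) \<longlonglongrightarrow> r - a \<bullet> 0" for a r
      by (intro tendsto_intros eps)
    then show "(\<lambda>n. sig (p n)) \<longlonglongrightarrow> sig z" "(\<lambda>n. phi (p n)) \<longlonglongrightarrow> phi z" "(\<lambda>n. psi (p n)) \<longlonglongrightarrow> psi z"
      unfolding pc by simp_all
  qed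
  have "p n \<in> cball z (c * (2 * Q + c * 1))" for n
  proof -
    have "norm (\<epsilon> n) \<le> 1" using tk(2)[of n] unfolding \<epsilon>_def
      by (smt (verit) inverse_le_1_iff of_nat_Suc of_nat_0_le_iff)
    then have "c * norm (\<epsilon> n) \<le> c * 1" using c(1) by (intro mult_left_mono) auto
    then have "N (\<epsilon> n) \<le> c * 1" using c(3)[of "\<epsilon> n"] by linarith
    then have e: "\<bar>a1 \<bullet> \<epsilon> n\<bar> \<le> c * 1" "\<bar>a2 \<bullet> \<epsilon> n\<bar> \<le> c * 1" "\<bar>a3 \<bullet> \<epsilon> n\<bar> \<le> c * 1"
      using coord_le_N order_trans by blast+
    have "\<bar>a1 \<bullet> (p n - z)\<bar> \<le> 2 * Q + c * 1"
      using coord_close(1)[of "p n"] coord_close(1)[of z] e(1) pc(1)[of n] by (simp add: inner_diff_right)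
    moreover have "\<bar>a2 \<bullet> (p n - z)\<bar> \<le> 2 * Q + c * 1"
      using coord_close(2)[of "p n"] coord_close(2)[of z] e(2) pc(2)[of n] by (simp add: inner_diff_right)
    moreover have "\<bar>a3 \<bullet> (p n - z)\<bar> \<le> 2 * Q + c * 1"
      using coord_close(3)[of "p n"] coord_close(3)[of z] e(3) pc(3)[of n] by (simp add: inner_diff_right)
    ultimately have "N (p n - z) \<le> 2 * Q + c * 1" by (simp add: N_def)
    then have "c * N (p n - z) \<le> c * (2 * Q + c * 1)" using c(1) by (intro mult_left_mono) auto
    with c(2)[of "p n - z"] show ?thesis by (simp add: dist_norm norm_minus_commute)
  qed
  then obtain l r where r: "strict_mono r" "(p \<circ> r) \<longlonglongrightarrow> l"
    using compact_cball compact_def by metis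
  have uniq: "f l = f z" if "continuous_on UNIV f" "(\<lambda>n. f (p n)) \<longlonglongrightarrow> f z" for f :: "real^3 \<Rightarrow> real"
  proof -
    have "isCont f l" using that(1) continuous_on_eq_continuous_at by blast
    then have "(\<lambda>n. f ((p \<circ> r) n)) \<longlonglongrightarrow> f l" using r(2) by (rule isCont_tendsto_compose)
    moreover have "(\<lambda>n. f ((p \<circ> r) n)) \<longlonglongrightarrow> f z"
      using LIMSEQ_subseq_LIMSEQ[OF that(2) r(1)] by (simp add: o_def)
    ultimately show ?thesis by (rule LIMSEQ_unique)
  qed
  \<comment> \<open>Injectivity of the coordinates turns convergence of coordinates into convergence
    of points.\<close>
  have "l = z"
    by (rule coord_inj) (use uniq coord_cont lim in blast)+
  then have pr: "(p \<circ> r) \<longlonglongrightarrow> z" using r(2) by simp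
  define s where "s = a3 \<bullet> z'"
  have const: "phi (om (p n) s) = phi (p n)" for n
  proof -
    have "om (p n) s + - k n \<in> W (p n + - k n)" by (rule W_lat[OF lat_minus[OF tk(1)] om(1)])
    then have "om (p n) s - k n \<in> W (Y n)" by (simp add: p_def)
    then have "phi (om (p n) s - k n) = phi (Y n)" using y0 W_trans[OF Y(1)] Y(1) by metis
    then show ?thesis
      using coord_lat(2)[OF tk(1), of "om (p n) s - k n" n] coord_lat(2)[OF tk(1), of "Y n" n] by (simp add: p_def)
  qed
  have "(\<lambda>i. om ((p \<circ> r) i) s) \<longlonglongrightarrow> z'"
    using om_tendsto[OF pr, of s] om_eqI[OF z'] by (simp add: s_def)
  moreover have cont: "isCont phi x" for x using coord_cont(2) continuous_on_eq_continuous_at by blast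
  ultimately have "(\<lambda>i. phi (om ((p \<circ> r) i) s)) \<longlonglongrightarrow> phi z'" by (rule isCont_tendsto_compose[rotated])
  moreover have "(\<lambda>i. phi (om ((p \<circ> r) i) s)) \<longlonglongrightarrow> phi z"
    using isCont_tendsto_compose[OF cont pr] by (simp add: const)
  ultimately show ?thesis by (rule LIMSEQ_unique)
qed

text \<open>Forward images of a stable curve have bounded length, so the difference of
  \<open>phi\<close> between its ends stays bounded although iteration multiplies it by
  \<open>l2\<close>.\<close>

lemma stable_leaf_constant:
  assumes "\<And>x n v. v \<in> E x \<Longrightarrow> norm (dF (F ^^ n) x v) \<le> C * lam ^ n * norm v"
    and "0 \<le> C" "0 \<le> lam" "lam \<le> 1" and z': "z' \<in> leaf E z"
  shows "phi z' = phi z"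
proof -
  obtain \<gamma> \<gamma>' where \<gamma>: "\<gamma> 0 = z" "\<gamma> 1 = z'" "continuous_on {0..1} \<gamma>'"
    "\<And>t. t \<in> {0..1} \<Longrightarrow> (\<gamma> has_vector_derivative \<gamma>' t) (at t within {0..1})"
    "\<And>t. t \<in> {0..1::real} \<Longrightarrow> \<gamma>' t \<in> E (\<gamma> t)"
    using z' unfolding leaf_def by blast
  have "bounded (\<gamma>' ` {0..1})"
    using compact_continuous_image[OF \<gamma>(3)] compact_imp_bounded by blast
  then obtain L where L: "\<And>t. t \<in> {0..1} \<Longrightarrow> norm (\<gamma>' t) \<le> L"
    unfolding bounded_iff by blast
  have "\<bar>l2 ^ n * (phi z' - phi z)\<bar> \<le> 2 * Q + c * (C * L)" for n
  proof -
    have "norm ((F ^^ n) (\<gamma> 1) - (F ^^ n) (\<gamma> 0)) \<le> C * L"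
    proof (rule path_image_bound[OF \<gamma>(4) funpow_differentiable[OF F_diff]])
      fix t :: real
      assume t: "t \<in> {0..1}"
      have "C * lam ^ n * norm (\<gamma>' t) \<le> C * 1 * L"
        using assms L[OF t] by (intro mult_mono mult_nonneg_nonneg power_le_one) auto
      then show "norm (dF (F ^^ n) (\<gamma> t) (\<gamma>' t)) \<le> C * L"
        using assms(1)[OF \<gamma>(5)[OF t], of n] by simp
    qed
    then have "c * norm ((F ^^ n) z' - (F ^^ n) z) \<le> c * (C * L)"
      using c(1) \<gamma> by (intro mult_left_mono) auto
    then have "\<bar>a2 \<bullet> ((F ^^ n) z' - (F ^^ n) z)\<bar> \<le> c * (C * L)"
      using c(3)[of "(F ^^ n) z' - (F ^^ n) z"] coord_le_N(2)[of "(F ^^ n) z' - (F ^^ n) z"] by linarith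
    then have "\<bar>phi ((F ^^ n) z') - phi ((F ^^ n) z)\<bar> \<le> 2 * Q + c * (C * L)"
      using coord_close(2)[of "(F ^^ n) z'"] coord_close(2)[of "(F ^^ n) z"]
      unfolding inner_diff_right by linarith
    then show ?thesis by (simp add: coord_conj right_diff_distrib)
  qed
  then show ?thesis using bounded_power_mult_eq_0[OF rates(2)] by force
qed

lemma countable_lat: "countable lat"
proof -
  have "lat \<subseteq> (\<lambda>(i, j, k). vector [of_int i, of_int j, of_int k] :: real^3) ` UNIV"
  proof
    fix x :: "real^3"
    assume "x \<in> lat"
    then have "\<forall>i. \<exists>j. x $ i = of_int j" by (auto simp: lat_def Ints_def)
    then obtain f where "\<And>i. x $ i = of_int (f i)" by metis
    then have "x = vector [of_int (f 1), of_int (f 2), of_int (f 3)]"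
      by (simp add: vec_eq_iff forall_3 vector_3)
    then show "x \<in> (\<lambda>(i, j, k). vector [of_int i, of_int j, of_int k] :: real^3) ` UNIV"
      by (intro image_eqI[of _ _ "(f 1, f 2, f 3)"]) auto
  qed
  then show ?thesis by (rule countable_subset) (intro countable_image countableI_type)
qed

lemma phi_surj: "\<exists>x. phi x = r"
proof -
  obtain x where x: "a2 \<bullet> x = 1" using coords_surj by blast
  have "continuous_on {r - Q..r + Q} (\<lambda>s. phi (s *\<^sub>R x))"
    by (intro continuous_on_compose2[OF coord_cont(2)] continuous_intros) auto
  moreover have "phi ((r - Q) *\<^sub>R x) \<le> r" "r \<le> phi ((r + Q) *\<^sub>R x)" "0 \<le> Q"
    using coord_close(2)[of "(r - Q) *\<^sub>R x"] coord_close(2)[of "(r + Q) *\<^sub>R x"] x by auto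
  ultimately show ?thesis
    using IVT'[of "\<lambda>s. phi (s *\<^sub>R x)" "r - Q" r "r + Q"] by auto
qed

lemma not_accessible:
  assumes "\<And>z z'. z' \<in> leaf Es z \<Longrightarrow> phi z' = phi z" "\<And>z z'. z' \<in> leaf Eu z \<Longrightarrow> phi z' = phi z"
  shows "\<not> accessible Es Eu"
proof
  assume acc: "accessible Es Eu"
  have "phi q = phi p" if "(su_step Es Eu)\<^sup>*\<^sup>* p q" for p q
    using that by induction (use assms in \<open>auto simp: su_step_def\<close>)
  then have "\<exists>k\<in>lat. phi (q + k) = phi 0" for q
    using acc unfolding accessible_def by metis
  then have "\<exists>k\<in>lat. phi q = phi 0 - a2 \<bullet> k" for q
    using coord_lat(2) by (metis add_diff_cancel_right')
  then have "UNIV \<subseteq> (\<lambda>k. phi 0 - a2 \<bullet> k) ` lat"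
    using phi_surj by (metis image_eqI subsetI)
  then have "countable (UNIV :: real set)"
    using countable_lat by (meson countable_image countable_subset)
  then show False using uncountable_UNIV_real by blast
qed

text \<open>Distance at most \<open>R\<close> from a translate of a set where \<open>a2\<close>
  vanishes bounds \<open>a2\<close>, hence \<open>phi\<close>, on the leaf; this starts the rigidity
  argument.\<close>

lemma unstable_leaf_unbounded:
  assumes ph: "ph_splitting F Es Ec Eu" and acc: "accessible Es Eu"
    and line: "\<And>v. v \<in> S \<Longrightarrow> a2 \<bullet> v = 0"
  shows "\<not> leaf Eu y \<subseteq> closed_nbhd R ((\<lambda>v. x + v) ` S)"
proof
  assume sub: "leaf Eu y \<subseteq> closed_nbhd R ((\<lambda>v. x + v) ` S)"
  have "subspace (Eu x)" "dim (Eu x) = 1" "dF F x ` Eu x = Eu (F x)" for x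
    using ph unfolding ph_splitting_def by blast+
  then interpret unstable_bundle A a1 a2 a3 v3 l1 l2 l3 \<delta> c B F G N Eu
    using unstable_in_cone[OF ph] by unfold_locales auto
  have bd: "\<bar>phi z - a2 \<bullet> x\<bar> \<le> c * R + Q" if z: "z \<in> W y" for z
  proof -
    obtain v where v: "v \<in> S" "dist z (x + v) \<le> R"
      using z sub leaf_eq_W unfolding closed_nbhd_def by auto
    have "c * norm (z - (x + v)) \<le> c * R"
      using v(2) c(1) by (intro mult_left_mono) (auto simp: dist_norm)
    then have "\<bar>a2 \<bullet> (z - (x + v))\<bar> \<le> c * R"
      using c(3)[of "z - (x + v)"] coord_le_N(2)[of "z - (x + v)"] by linarith
    then show ?thesis
      using coord_close(2)[of z] line[OF v(1)] by (simp add: inner_diff_right inner_add_right)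
  qed
  have "\<bar>phi z - phi y\<bar> \<le> (c * R + Q) + (c * R + Q)" if "z \<in> W y" for z
    using bd[OF that] bd[OF W_refl] by linarith
  then obtain y0 where "\<forall>z\<in>W y0. phi z = phi y0" using constant_leaf_exists by blast
  then have u: "phi z' = phi z" if "z' \<in> leaf Eu z" for z z'
    using all_leaves_constant that leaf_eq_W by blast
  obtain C lam gh g mu where r: "C \<ge> 1" "0 < lam" "lam < gh" "gh < 1"
    and Es: "\<And>x n v. v \<in> Es x \<Longrightarrow> norm (dF (F ^^ n) x v) \<le> C * lam ^ n * norm v"
    by (rule ph_splitting_rates[OF ph]) (rule that; blast)
  have s: "phi z' = phi z" if "z' \<in> leaf Es z" for z z'
    by (rule stable_leaf_constant[OF Es]) (use r that in auto)
  show False using not_accessible[OF s u] acc by blast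
qed

end

subsection \<open>Integer vectors and lifts\<close>

lemma latD: "k \<in> lat \<Longrightarrow> k $ i \<in> \<int>"
  by (simp add: lat_def)

lemma lat_diff: "j \<in> lat \<Longrightarrow> k \<in> lat \<Longrightarrow> j - k \<in> lat"
  by (simp add: lat_def)

lemma lat_small:
  assumes "k \<in> lat" "norm k < 1"
  shows "k = 0"
proof -
  have "k $ i = 0" for i
  proof -
    have "\<bar>k $ i\<bar> < 1" using component_le_norm_cart[of k i] assms(2) by linarith
    with latD[OF assms(1)] show ?thesis by (meson Ints_nonzero_abs_less1)
  qed
  then show ?thesis by (simp add: vec_eq_iff)
qed

lemma tpi_eq_iff: "tpi x = tpi y \<longleftrightarrow> x - y \<in> lat"
proof -
  have "frac a = frac b \<longleftrightarrow> a - b \<in> \<int>" for a b :: real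
  proof
    assume "frac a = frac b"
    then have "a - b = of_int (\<lfloor>a\<rfloor> - \<lfloor>b\<rfloor>)" by (simp add: frac_def)
    then show "a - b \<in> \<int>" by simp
  next
    assume "a - b \<in> \<int>"
    from frac_add_int_left[OF this, of b] show "frac a = frac b" by simp
  qed
  then show ?thesis by (simp add: tpi_def lat_def vec_eq_iff)
qed

lemma continuous_lat_constant:
  fixes h :: "real^3 \<Rightarrow> real^3"
  assumes "continuous_on UNIV h" "\<And>x. h x \<in> lat"
  shows "h x = h y"
proof -
  have "h x $ i = h y $ i" for i
  proof -
    have "(\<lambda>x. h x $ i) constant_on UNIV"
    proof (rule continuous_discrete_range_constant)
      show "continuous_on UNIV (\<lambda>x. h x $ i)" using assms(1) by (intro continuous_intros)
      show "\<exists>e>0. \<forall>y. y \<in> UNIV \<and> h y $ i \<noteq> h x $ i \<longrightarrow> e \<le> norm (h y $ i - h x $ i)" for x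
      proof (intro exI[of _ 1] conjI allI impI)
        fix y
        assume "y \<in> UNIV \<and> h y $ i \<noteq> h x $ i"
        moreover have "h y $ i - h x $ i \<in> \<int>" using assms(2) latD by (intro Ints_diff) auto
        ultimately show "1 \<le> norm (h y $ i - h x $ i)" by (auto intro: Ints_nonzero_abs_ge1)
      qed simp
    qed (rule connected_UNIV)
    then show ?thesis by (metis UNIV_I constant_on_def)
  qed
  then show ?thesis by (simp add: vec_eq_iff)
qed

text \<open>The difference of two lifts is continuous with values in the discrete set
  \<open>lat\<close>.\<close>

lemma lift_unique:
  assumes "is_lift f F" "is_lift f F'"
  obtains k where "k \<in> lat" "\<And>x. F x = F' x + k"
proof -
  have "F x - F' x \<in> lat" for x
    using assms by (simp add: is_lift_def flip: tpi_eq_iff)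
  moreover have "continuous_on UNIV (\<lambda>x. F x - F' x)"
    using assms by (intro continuous_intros) (auto simp: is_lift_def)
  ultimately have "F x - F' x = F 0 - F' 0" for x
    by (rule continuous_lat_constant[rotated])
  then have "F x = F' x + (F 0 - F' 0)" for x by (metis add.commute diff_add_cancel)
  with \<open>\<And>x. F x - F' x \<in> lat\<close> that show ?thesis by blast
qed

section \<open>Integer matrices of determinant one and irrationality of their eigenlines\<close>

lemma SL3Z_transpose: "SL3Z A \<Longrightarrow> SL3Z (transpose A)"
  by (simp add: SL3Z_def transpose_def[of A] flip: det_transpose[of A])

lemma SL3Z_lat:
  assumes "SL3Z A" "k \<in> lat"
  shows "A *v k \<in> lat"
  using assms unfolding SL3Z_def lat_def matrix_vector_mult_def
  by (auto intro!: Ints_sum Ints_mult)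

text \<open>Cramer's rule: the solution consists of integer determinants divided by
  \<open>det A = 1\<close>.\<close>

lemma SL3Z_lat_surj:
  assumes "SL3Z A" "k \<in> lat"
  shows "\<exists>j\<in>lat. A *v j = k"
proof
  let ?x = "(\<chi> j. det (\<chi> i i'. if i' = j then k $ i else A $ i $ i') / det A) :: real^3"
  have "det A = 1" using assms by (simp add: SL3Z_def)
  then show "A *v ?x = k" using cramer[of A ?x k] by simp
  show "?x \<in> lat"
    using assms unfolding SL3Z_def lat_def
    by (auto simp: det_def intro!: Ints_sum Ints_mult Ints_prod)
qed

lemma SL3Z_inj:
  assumes "SL3Z A" "A *v x = A *v y"
  shows "x = y"
  using assms inj_matrix_vector_mult[of A] invertible_det_nz[of A] by (simp add: SL3Z_def inj_eq)

text \<open>Otherwise the vectors \<open>r ^ n *\<^sub>R k\<close> would be nonzero integer vectors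
  tending to 0. Closure under scaling is asked only on the line of \<open>k\<close>, where a matrix
  with eigenvector \<open>k\<close> acts as a scalar.\<close>

lemma lat_scaled_zero:
  assumes "k \<in> lat" "\<bar>r\<bar> < 1" and step: "\<And>j. j \<in> lat \<Longrightarrow> \<exists>s. j = s *\<^sub>R k \<Longrightarrow> r *\<^sub>R j \<in> lat"
  shows "r = 0 \<or> k = 0"
proof -
  have in_lat: "r ^ n *\<^sub>R k \<in> lat" for n
  proof (induction n)
    case (Suc n)
    have "r *\<^sub>R (r ^ n *\<^sub>R k) \<in> lat" by (rule step[OF Suc]) blast
    then show ?case by simp
  qed (use assms in simp)
  have "(\<lambda>n. norm (r ^ n *\<^sub>R k)) \<longlonglongrightarrow> norm (0 *\<^sub>R k)"
    using assms(2) by (intro tendsto_intros LIMSEQ_power_zero) auto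
  then have "\<forall>\<^sub>F n in sequentially. norm (r ^ n *\<^sub>R k) < 1"
    by (rule order_tendstoD) simp
  then obtain n where "norm (r ^ n *\<^sub>R k) < 1" using eventually_happens by force
  then have "r ^ n *\<^sub>R k = 0" by (rule lat_small[OF in_lat])
  then show ?thesis by auto
qed

text \<open>Iterating \<open>A\<close> contracts the integer points on the line if
  \<open>\<bar>r\<bar> < 1\<close>, and iterating its inverse does so if
  \<open>\<bar>r\<bar> > 1\<close>; both maps preserve \<open>lat\<close>.\<close>

lemma integer_eigenvector:
  assumes "SL3Z A" "k \<in> lat" "k \<noteq> 0" "A *v k = r *\<^sub>R k"
  shows "\<bar>r\<bar> = 1"
proof (rule ccontr)
  have "r \<noteq> 0"
  proof
    assume "r = 0"
    then have "A *v k = A *v 0" using assms(4) by simp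
    then show False using SL3Z_inj[OF assms(1)] assms(3) by blast
  qed
  assume "\<bar>r\<bar> \<noteq> 1"
  then consider "\<bar>r\<bar> < 1" | "\<bar>1 / r\<bar> < 1" by fastforce
  then show False
  proof cases
    case 1
    have "r *\<^sub>R j \<in> lat" if "j \<in> lat" "\<exists>s. j = s *\<^sub>R k" for j
    proof -
      have "A *v j = r *\<^sub>R j" using that(2) assms(4) by (auto simp: matrix_vector_mult_scaleR)
      then show ?thesis using SL3Z_lat[OF assms(1) that(1)] by simp
    qed
    then show False using lat_scaled_zero[OF assms(2) 1] \<open>r \<noteq> 0\<close> assms(3) by blast
  next
    case 2
    have "(1 / r) *\<^sub>R j \<in> lat" if j: "j \<in> lat" "\<exists>s. j = s *\<^sub>R k" for j
    proof -
      have "A *v ((1 / r) *\<^sub>R j) = j" using j(2) assms(4) \<open>r \<noteq> 0\<close> by (auto simp: matrix_vector_mult_scaleR)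
      moreover obtain i where "i \<in> lat" "A *v i = j" using SL3Z_lat_surj[OF assms(1) j(1)] by blast
      ultimately show ?thesis using SL3Z_inj[OF assms(1)] by metis
    qed
    then show False using lat_scaled_zero[OF assms(2) 2] \<open>r \<noteq> 0\<close> assms(3) by simp
  qed
qed

text \<open>The eigenvectors form a basis. To see independence, \<open>A - m3\<close> and then
  \<open>A - m2\<close> are applied to a linear relation, which leaves only the term of
  \<open>w1\<close>.\<close>

lemma eigenvectors_orthogonal_zero:
  fixes A :: "real^3^3"
  assumes ev: "A *v w1 = m1 *\<^sub>R w1" "A *v w2 = m2 *\<^sub>R w2" "A *v w3 = m3 *\<^sub>R w3"
    and nz: "w1 \<noteq> 0" "w2 \<noteq> 0" "w3 \<noteq> 0" and d: "m1 \<noteq> m2" "m1 \<noteq> m3" "m2 \<noteq> m3"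
    and x: "w1 \<bullet> x = 0" "w2 \<bullet> x = 0" "w3 \<bullet> x = 0"
  shows "x = 0"
proof -
  define S where "S r = r $ 1 *\<^sub>R w1 + r $ 2 *\<^sub>R w2 + r $ 3 *\<^sub>R w3" for r :: "real^3"
  have lin: "linear S"
    by (rule linearI) (simp_all add: S_def algebra_simps)
  moreover have "inj S"
    unfolding linear_injective_0[OF lin]
  proof (intro allI impI)
    fix r
    assume "S r = 0"
    then have S: "r $ 1 *\<^sub>R w1 + r $ 2 *\<^sub>R w2 + r $ 3 *\<^sub>R w3 = 0" by (simp add: S_def)
    have "A *v (r $ 1 *\<^sub>R w1 + r $ 2 *\<^sub>R w2 + r $ 3 *\<^sub>R w3) = 0" unfolding S by simp
    then have AS: "m1 *\<^sub>R (r $ 1 *\<^sub>R w1) + m2 *\<^sub>R (r $ 2 *\<^sub>R w2) + m3 *\<^sub>R (r $ 3 *\<^sub>R w3) = 0"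
      by (simp add: matrix_vector_right_distrib matrix_vector_mult_scaleR ev mult.commute)
    have 12: "((m1 - m3) * r $ 1) *\<^sub>R w1 + ((m2 - m3) * r $ 2) *\<^sub>R w2 = 0"
    proof -
      have "((m1 - m3) * r $ 1) *\<^sub>R w1 + ((m2 - m3) * r $ 2) *\<^sub>R w2
        = (m1 *\<^sub>R (r $ 1 *\<^sub>R w1) + m2 *\<^sub>R (r $ 2 *\<^sub>R w2) + m3 *\<^sub>R (r $ 3 *\<^sub>R w3))
          - m3 *\<^sub>R (r $ 1 *\<^sub>R w1 + r $ 2 *\<^sub>R w2 + r $ 3 *\<^sub>R w3)"
        by (simp add: algebra_simps)
      then show ?thesis using AS S by simp
    qed
    have "A *v (((m1 - m3) * r $ 1) *\<^sub>R w1 + ((m2 - m3) * r $ 2) *\<^sub>R w2) = 0" unfolding 12 by simp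
    then have A12: "m1 *\<^sub>R (((m1 - m3) * r $ 1) *\<^sub>R w1) + m2 *\<^sub>R (((m2 - m3) * r $ 2) *\<^sub>R w2) = 0"
      by (simp add: matrix_vector_right_distrib matrix_vector_mult_scaleR ev mult.commute)
    have "((m1 - m2) * ((m1 - m3) * r $ 1)) *\<^sub>R w1
        = (m1 *\<^sub>R (((m1 - m3) * r $ 1) *\<^sub>R w1) + m2 *\<^sub>R (((m2 - m3) * r $ 2) *\<^sub>R w2))
          - m2 *\<^sub>R (((m1 - m3) * r $ 1) *\<^sub>R w1 + ((m2 - m3) * r $ 2) *\<^sub>R w2)"
      by (simp add: algebra_simps)
    then have "((m1 - m2) * ((m1 - m3) * r $ 1)) *\<^sub>R w1 = 0" using A12 12 by simp
    then have r1: "r $ 1 = 0" using nz d by auto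
    then have r2: "r $ 2 = 0" using 12 nz d by auto
    then have "r $ 3 = 0" using S r1 nz by auto
    then show "r = 0" using r1 r2 by (simp add: vec_eq_iff forall_3)
  qed
  ultimately have "surj S" by (intro linear_injective_imp_surjective) auto
  then obtain r where "x = S r" by (metis surjD)
  then have "x \<bullet> x = S r \<bullet> x" by simp
  also have "\<dots> = 0" by (simp add: S_def inner_add_left x)
  finally show ?thesis by simp
qed

text \<open>\<open>A - mat l\<close> and its transpose have the same determinant, so an eigenvalue
  of \<open>A\<close> is one of the transpose.\<close>

lemma left_eigenvector:
  fixes A :: "real^3^3"
  assumes "is_eigenvalue A l"
  obtains a where "a \<noteq> 0" "transpose A *v a = l *\<^sub>R a" "\<And>x. a \<bullet> (A *v x) = l * (a \<bullet> x)"
proof -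
  have matl: "mat l *v x = l *\<^sub>R x" for x :: "real^3"
    by (simp add: vec_eq_iff matrix_vector_mult_def mat_def if_distrib[of "\<lambda>a. a * x $ _"] cong: if_cong)
  have ker: "(\<exists>x. x \<noteq> 0 \<and> M *v x = 0) \<longleftrightarrow> det M = 0" for M :: "real^3^3"
    using invertible_det_nz[of M] matrix_left_invertible_ker[of M] invertible_left_inverse[of M] by metis
  obtain v where "v \<noteq> 0" "A *v v = l *\<^sub>R v" using assms is_eigenvalue_def by blast
  then have "(A - mat l) *v v = 0" by (simp add: matrix_vector_mult_diff_rdistrib matl)
  with \<open>v \<noteq> 0\<close> have "det (A - mat l) = 0" using ker by blast
  moreover have "transpose (A - mat l) = transpose A - mat l"
    by (auto simp: transpose_def mat_def vec_eq_iff)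
  ultimately have "det (transpose A - mat l) = 0" by (metis det_transpose)
  then obtain a where a: "a \<noteq> 0" "(transpose A - mat l) *v a = 0" using ker by blast
  then have e: "transpose A *v a = l *\<^sub>R a" by (simp add: matrix_vector_mult_diff_rdistrib matl)
  have "a \<bullet> (A *v x) = l * (a \<bullet> x)" for x
    using e dot_lmul_matrix[of a A x] by simp
  with a e that show ?thesis by blast
qed

text \<open>If \<^term>\<open>k\<close> is an integer vector orthogonal to the eigenvector \<^term>\<open>v3\<close>, then either
  \<^term>\<open>k\<close> is an eigenvector of the transpose, or its cross product with \<^term>\<open>transpose A *v k\<close>
  is an integer vector proportional to \<^term>\<open>v3\<close>; both contradict \<open>integer_eigenvector\<close>.\<close>

lemma eigenvector_irrational:
  assumes A: "SL3Z A" and ev: "A *v v1 = l1 *\<^sub>R v1" "A *v v2 = l2 *\<^sub>R v2" "A *v v3 = l3 *\<^sub>R v3"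
    and nz: "v1 \<noteq> 0" "v2 \<noteq> 0" "v3 \<noteq> 0" and d: "l1 \<noteq> l2" "l1 \<noteq> l3" "l2 \<noteq> l3"
    and abs: "\<bar>l1\<bar> \<noteq> 1" "\<bar>l2\<bar> \<noteq> 1" "\<bar>l3\<bar> \<noteq> 1"
    and k: "k \<in> lat" "k \<bullet> v3 = 0"
  shows "k = 0"
proof (rule ccontr)
  assume k0: "k \<noteq> 0"
  define k' where "k' = transpose A *v k"
  have k'_lat: "k' \<in> lat" unfolding k'_def by (rule SL3Z_lat[OF SL3Z_transpose[OF A] k(1)])
  have k': "k' \<bullet> x = k \<bullet> (A *v x)" for x
    using dot_lmul_matrix[of k A x] by (simp add: k'_def)
  define w where "w = cross3 k k'"
  show False
  proof (cases "w = 0")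
    case True
    then have "collinear {0, k, k'}" by (simp add: w_def cross_eq_0)
    then obtain r where r: "k' = r *\<^sub>R k" using k0 by (auto simp: collinear_lemma)
    have "\<bar>r\<bar> = 1"
      using integer_eigenvector[OF SL3Z_transpose[OF A] k(1) k0, of r] r by (simp add: k'_def)
    have "v \<bullet> k = 0" if "A *v v = l *\<^sub>R v" "\<bar>l\<bar> \<noteq> 1" for v l
    proof -
      have "r * (k \<bullet> v) = l * (k \<bullet> v)" using k'[of v] that(1) r by simp
      then show ?thesis using \<open>\<bar>r\<bar> = 1\<close> that(2) by (auto simp: inner_commute)
    qed
    then have "k = 0" using eigenvectors_orthogonal_zero[OF ev nz d, of k] ev abs by blast
    with k0 show False by simp
  next
    case False
    have "w \<in> lat"
      using latD[OF k(1)] latD[OF k'_lat] unfolding lat_def mem_Collect_eq forall_3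
      by (simp add: w_def cross3_def)
    moreover have "A *v w = l3 *\<^sub>R w"
    proof -
      have "k' \<bullet> v3 = 0" using k'[of v3] ev(3) k(2) by simp
      have "cross3 w v3 = 0"
      proof -
        have "cross3 (cross3 k k') v3 = (k \<bullet> v3) *\<^sub>R k' - (k' \<bullet> v3) *\<^sub>R k"
          by (simp add: cross3_def vec_eq_iff forall_3 vector_3 inner_vec_def sum_3 algebra_simps)
        then show ?thesis using k(2) \<open>k' \<bullet> v3 = 0\<close> by (simp add: w_def)
      qed
      then have "collinear {0, v3, w}" by (simp add: cross_eq_0 insert_commute)
      then obtain r where "w = r *\<^sub>R v3" using nz(3) by (auto simp: collinear_lemma)
      then show ?thesis by (simp add: matrix_vector_mult_scaleR ev(3))
    qed
    ultimately show False using integer_eigenvector[OF A _ False] abs(3) by blast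
  qed
qed

text \<open>The hypothesis says that the entries of \<open>v\<close> are linearly independent over
  the integers, which is the condition of Kronecker's theorem for a real multiplier
  \<open>t\<close>.\<close>

lemma irrational_line_dense:
  fixes v :: "real^3"
  assumes irr: "\<And>k. k \<in> lat \<Longrightarrow> k \<bullet> v = 0 \<Longrightarrow> k = 0" and e: "e > 0"
  shows "\<exists>t. \<exists>k\<in>lat. norm (x - t *\<^sub>R v - k) < e"
proof -
  \<comment> \<open>Kronecker's theorem numbers the frequencies by naturals below 3, whereas vector
    entries are indexed by the type \<open>3\<close>.\<close>
  define idx where "idx i = (if i = 0 then 1 else if i = 1 then 2 else 3 :: 3)" for i :: nat
  have idx_bij: "bij_betw idx {..<3} UNIV"
    unfolding bij_betw_def
  proof
    show "inj_on idx {..<3}" by (auto simp: inj_on_def idx_def split: if_splits)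
    have "{..<3} = {0, 1, 2 :: nat}" by auto
    then show "idx ` {..<3} = UNIV" by (auto simp: idx_def UNIV_3)
  qed
  have irr': "c i = 0" if "i < 3" "(\<Sum>i<3. of_int (c i) * v $ idx i) = 0" for c :: "nat \<Rightarrow> int" and i
  proof -
    define k :: "real^3" where "k = (\<chi> j. of_int (c (inv_into {..<3} idx j)))"
    have inv: "inv_into {..<3} idx (idx i) = i" if "i < 3" for i
      using idx_bij that by (simp add: bij_betw_def)
    have "k \<bullet> v = (\<Sum>j\<in>UNIV. k $ j * v $ j)" by (simp add: inner_vec_def)
    also have "\<dots> = (\<Sum>i<3. k $ idx i * v $ idx i)"
      by (rule sum.reindex_bij_betw[OF idx_bij, symmetric])
    also have "\<dots> = (\<Sum>i<3. of_int (c i) * v $ idx i)"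
      by (rule sum.cong) (auto simp: k_def inv)
    also have "\<dots> = 0" by (rule that(2))
    finally have "k = 0" using irr by (simp add: k_def lat_def)
    then have "k $ idx i = 0" by simp
    then show "c i = 0" using inv[OF that(1)] by (simp add: k_def)
  qed
  define \<theta> where "\<theta> i = v $ idx i" for i
  \<comment> \<open>Independence concerns the set of frequencies, so coincidences are excluded
    separately, by a relation with coefficients 1 and -1.\<close>
  have inj: "inj_on \<theta> {..<3}"
  proof (rule inj_onI, rule ccontr)
    fix i j :: nat
    assume ij: "i \<in> {..<3}" "j \<in> {..<3}" "\<theta> i = \<theta> j" "i \<noteq> j"
    define c where "c l = (if l = i then 1 else if l = j then -1 else 0 :: int)" for l
    have "(\<Sum>l<3. of_int (c l) * v $ idx l) = (\<Sum>l<3. (if l = i then \<theta> i else 0) - (if l = j then \<theta> j else 0))"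
      using ij(4) by (intro sum.cong) (auto simp: c_def \<theta>_def)
    also have "\<dots> = 0" using ij by (simp add: sum_subtractf)
    finally have "c i = 0" using irr'[of i c] ij(1) by simp
    then show False by (simp add: c_def)
  qed
  interpret M: Modules.module "\<lambda>r. (*) (real_of_int r)"
    by (simp add: Modules.module.intro distrib_left mult.commute)
  have indep: "M.independent (\<theta> ` {..<3})"
  proof
    assume "M.dependent (\<theta> ` {..<3})"
    then obtain T u where T: "finite T" "T \<subseteq> \<theta> ` {..<3}" "(\<Sum>a\<in>T. of_int (u a) * a) = 0" "\<exists>a\<in>T. u a \<noteq> 0"
      unfolding M.dependent_explicit by blast
    define c where "c i = (if \<theta> i \<in> T then u (\<theta> i) else 0)" for i
    have "(\<Sum>i<3. of_int (c i) * v $ idx i) = (\<Sum>i<3. if \<theta> i \<in> T then of_int (u (\<theta> i)) * \<theta> i else 0)"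
      by (rule sum.cong) (auto simp: c_def \<theta>_def)
    also have "\<dots> = (\<Sum>a\<in>\<theta> ` {..<3}. if a \<in> T then of_int (u a) * a else 0)"
      by (simp add: sum.reindex[OF inj])
    also have "\<dots> = (\<Sum>a\<in>T. of_int (u a) * a)"
      using T(2) by (simp add: sum.If_cases Int_absorb1)
    finally have "c i = 0" if "i < 3" for i using irr'[OF that] T(3) by simp
    moreover obtain i where "i < 3" "\<theta> i \<in> T" "u (\<theta> i) \<noteq> 0" using T(2,4) by blast
    ultimately show False by (metis c_def)
  qed
  obtain t h where th: "\<And>i. i < 3 \<Longrightarrow> \<bar>t * \<theta> i - of_int (h i) - x $ idx i\<bar> < e / 3"
    using Kronecker_thm_1[OF indep inj, of "e / 3" "\<lambda>i. x $ idx i"] e by auto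
  define k :: "real^3" where "k = (\<chi> j. - of_int (h (inv_into {..<3} idx j)))"
  have "\<bar>(x - t *\<^sub>R v - k) $ j\<bar> < e / 3" for j
  proof -
    obtain i where i: "i < 3" "j = idx i" using idx_bij by (metis UNIV_I bij_betw_def imageE lessThan_iff)
    have "inv_into {..<3} idx j = i" using idx_bij i by (simp add: bij_betw_def)
    then have "(x - t *\<^sub>R v - k) $ j = - (t * \<theta> i - of_int (h i) - x $ idx i)"
      by (simp add: k_def i(2) \<theta>_def)
    then show ?thesis using th[OF i(1)] by (simp only: abs_minus_cancel)
  qed
  moreover have "norm (x - t *\<^sub>R v - k) \<le> (\<Sum>j\<in>UNIV. \<bar>(x - t *\<^sub>R v - k) $ j\<bar>)" by (rule norm_le_l1_cart)
  ultimately have "norm (x - t *\<^sub>R v - k) < e / 3 + e / 3 + e / 3"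
    unfolding sum_3 by (meson add_strict_mono le_less_trans)
  moreover have "k \<in> lat" by (simp add: k_def lat_def)
  ultimately show ?thesis by auto
qed

theorem theorem1:
  fixes A :: "real^3^3" and l1 l2 l3 :: real
  assumes "SL3Z A"
    and "0 < l1" "l1 < 1" "1 < l2" "l2 < l3"
    and "is_eigenvalue A l1" "is_eigenvalue A l2" "is_eigenvalue A l3"
  shows "\<exists>eps > 0. \<forall>f. torus_C1_diffeo f \<and> C1_close eps A f \<longrightarrow>
           (\<forall>F Es Ec Eu. is_lift f F \<and> ph_splitting F Es Ec Eu \<and> accessible Es Eu \<longrightarrow>
              (\<forall>R > 0. \<forall>x y. \<not> leaf Eu y \<subseteq> closed_nbhd R ((\<lambda>v. x + v) ` eigenline A l3)))"
proof -
  obtain a1 where a1: "a1 \<noteq> 0" "transpose A *v a1 = l1 *\<^sub>R a1" "\<And>x. a1 \<bullet> (A *v x) = l1 * (a1 \<bullet> x)"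
    using left_eigenvector[OF assms(6)] by blast
  obtain a2 where a2: "a2 \<noteq> 0" "transpose A *v a2 = l2 *\<^sub>R a2" "\<And>x. a2 \<bullet> (A *v x) = l2 * (a2 \<bullet> x)"
    using left_eigenvector[OF assms(7)] by blast
  obtain a3 where a3: "a3 \<noteq> 0" "transpose A *v a3 = l3 *\<^sub>R a3" "\<And>x. a3 \<bullet> (A *v x) = l3 * (a3 \<bullet> x)"
    using left_eigenvector[OF assms(8)] by blast
  have dist: "l1 \<noteq> l2" "l1 \<noteq> l3" "l2 \<noteq> l3" and abs: "\<bar>l1\<bar> \<noteq> 1" "\<bar>l2\<bar> \<noteq> 1" "\<bar>l3\<bar> \<noteq> 1"
    using assms by auto
  have ker: "x = 0" if "a1 \<bullet> x = 0" "a2 \<bullet> x = 0" "a3 \<bullet> x = 0" for x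
    by (rule eigenvectors_orthogonal_zero[OF a1(2) a2(2) a3(2) a1(1) a2(1) a3(1) dist that])
  obtain w1 w2 w3 where w: "w1 \<noteq> 0" "w2 \<noteq> 0" "w3 \<noteq> 0" "A *v w1 = l1 *\<^sub>R w1" "A *v w2 = l2 *\<^sub>R w2" "A *v w3 = l3 *\<^sub>R w3"
    using assms(6-8) unfolding is_eigenvalue_def by blast
  have line: "a1 \<bullet> v = 0" "a2 \<bullet> v = 0" if "A *v v = l3 *\<^sub>R v" for v
    using a1(3)[of v] a2(3)[of v] dist that by auto
  have w3: "a3 \<bullet> w3 \<noteq> 0" using ker line[OF w(6)] w(3) by blast
  define v3 where "v3 = (1 / (a3 \<bullet> w3)) *\<^sub>R w3"
  have v3: "a1 \<bullet> v3 = 0" "a2 \<bullet> v3 = 0" "a3 \<bullet> v3 = 1" "v3 \<noteq> 0" "A *v v3 = l3 *\<^sub>R v3"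
    using line[OF w(6)] w3 w by (auto simp: v3_def matrix_vector_mult_scaleR)
  have dense: "\<exists>t. \<exists>k\<in>lat. norm (x - t *\<^sub>R v3 - k) < e" if "e > 0" for x e
    by (rule irrational_line_dense[OF eigenvector_irrational[OF assms(1) w(4,5) v3(5) w(1,2) v3(4) dist abs] that])
  define N where "N x = max \<bar>a1 \<bullet> x\<bar> (max \<bar>a2 \<bullet> x\<bar> \<bar>a3 \<bullet> x\<bar>)" for x
  define T where "T x = (vector [a1 \<bullet> x, a2 \<bullet> x, a3 \<bullet> x] :: real^3)" for x
  have T_lin: "linear T"
    by (rule linearI) (simp_all add: T_def vec_eq_iff forall_3 vector_3 inner_add_right)
  moreover have "inj T"
    unfolding linear_injective_0[OF T_lin] using ker by (simp add: T_def vec_eq_iff forall_3 vector_3)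
  ultimately have "\<exists>b>0. \<forall>x. b * norm x \<le> norm (T x)"
    using linear_inj_bounded_below_pos by metis
  then obtain b where b: "b > 0" "\<And>x. b * norm x \<le> norm (T x)"
    by blast
  \<comment> \<open>The part \<open>3 / b\<close> gives \<open>norm x \<le> c * N x\<close>, as the
    three coordinates sum to at most \<open>3 * N x\<close>; the norms of the functionals give the
    reverse estimate by Cauchy-Schwarz.\<close>
  define c where "c = 3 / b + (norm a1 + norm a2 + norm a3)"
  have c: "c > 0" using b a1(1) by (simp add: c_def add_pos_nonneg)
  have N_nonneg: "0 \<le> N x" for x by (simp add: N_def)
  have c1: "norm x \<le> c * N x" for x
  proof -
    have "norm (T x) \<le> \<bar>a1 \<bullet> x\<bar> + \<bar>a2 \<bullet> x\<bar> + \<bar>a3 \<bullet> x\<bar>"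
      using norm_le_l1_cart[of "T x"] by (simp add: T_def sum_3 vector_3)
    also have "\<dots> \<le> 3 * N x" unfolding N_def by linarith
    finally have "norm x \<le> 3 / b * N x" using b(1) b(2)[of x] by (simp add: field_simps)
    also have "\<dots> \<le> c * N x"
      unfolding c_def by (intro mult_right_mono N_nonneg) simp
    finally show ?thesis .
  qed
  have c2: "N x \<le> c * norm x" for x
  proof -
    have "\<bar>a \<bullet> x\<bar> \<le> c * norm x" if "norm a \<le> c" for a
      using Cauchy_Schwarz_ineq2[of a x] mult_right_mono[OF that norm_ge_zero[of x]] by linarith
    moreover have "norm a1 \<le> c" "norm a2 \<le> c" "norm a3 \<le> c" using b(1) by (auto simp: c_def)
    ultimately show ?thesis by (simp add: N_def)
  qed
  \<comment> \<open>Two errors \<delta> fall into the gap between \<open>l2\<close> and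
    \<open>l3\<close>, so a third of it keeps the rates strictly apart; half of the distance to 1
    suffices for the others.\<close>
  define \<delta> where "\<delta> = min ((1 - l1) / 2) (min ((l2 - 1) / 2) ((l3 - l2) / 3))"
  have \<delta>: "0 < \<delta>" "l1 + \<delta> < 1" "1 < l2 - \<delta>" "l2 + \<delta> < l3 - \<delta>"
    using assms(2-5) by (auto simp: \<delta>_def min_def field_simps)
  \<comment> \<open>The factor \<open>c * c\<close> pays for passing from \<open>norm\<close> to
    \<open>N\<close> on both sides of the Lipschitz bound; \<open>1 / 3\<close> makes integer
    vectors of size below \<open>2 * eps\<close> vanish.\<close>
  define eps where "eps = min (\<delta> / (c * c)) (1 / 3)"
  have eps: "0 < eps" "c * (eps * c) \<le> \<delta>" "eps \<le> 1 / 3"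
    using \<delta>(1) c by (auto simp: eps_def min_def field_simps)
  have N_small: "N e \<le> \<delta> * N v" if "norm e \<le> eps * norm v" for e v
  proof -
    have "eps * norm v \<le> eps * (c * N v)" using c1 eps(1) by (intro mult_left_mono) auto
    then have "c * norm e \<le> c * (eps * (c * N v))" using that c by (intro mult_left_mono) auto
    also have "\<dots> = c * (eps * c) * N v" by simp
    also have "\<dots> \<le> \<delta> * N v" by (intro mult_right_mono eps N_nonneg)
    finally show ?thesis using c2[of e] by linarith
  qed
  have main: "\<not> leaf Eu y \<subseteq> closed_nbhd R ((\<lambda>v. x + v) ` eigenline A l3)"
    if f: "torus_C1_diffeo f" "C1_close eps A f" and F: "is_lift f F"
      and ph: "ph_splitting F Es Ec Eu" and acc: "accessible Es Eu" for f F Es Ec Eu R x y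
  proof -
    \<comment> \<open>Closeness to \<open>A\<close> and invertibility are each known for some lift.
      The given \<open>F\<close> differs from both by integer translations and inherits both
      properties.\<close>
    obtain F1 where F1: "is_lift f F1" "C1_map F1" "\<And>x. norm (F1 x - A *v x) < eps"
        "\<And>x. onorm (\<lambda>v. dF F1 x v - A *v v) < eps"
      using f(2) unfolding C1_close_def by blast
    obtain F0 where F0: "is_lift f F0" "C1_diffeo F0"
      using f(1) unfolding torus_C1_diffeo_def by blast
    obtain k0 where k0: "k0 \<in> lat" "\<And>x. F x = F0 x + k0" using lift_unique[OF F F0(1)] by blast
    obtain k1 where k1: "k1 \<in> lat" "\<And>x. F x = F1 x + k1" using lift_unique[OF F F1(1)] by blast
    have F1_diff: "F1 differentiable (at x)" for x using F1(2) unfolding C1_map_def by blast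
    have F_der: "(F has_derivative dF F1 x) (at x)" for x
    proof -
      have "((\<lambda>x. F1 x + k1) has_derivative (\<lambda>v. dF F1 x v + 0)) (at x)"
        by (intro has_derivative_add has_derivative_const has_derivative_dF F1_diff)
      moreover have "F = (\<lambda>x. F1 x + k1)" using k1(2) by (rule ext)
      ultimately show ?thesis by simp
    qed
    have dF_F: "dF F x = dF F1 x" for x using dF_eqI[OF F_der] .
    define H where "H = inv F0"
    have bij: "bij F0" and H: "C1_map H" using F0(2) unfolding C1_diffeo_def H_def by blast+
    have F0H: "F0 (H x) = x" "H (F0 x) = x" for x
      using bij by (simp_all add: H_def bij_is_inj bij_is_surj surj_f_inv_f)
    have H_diff: "H differentiable (at x)" for x using H unfolding C1_map_def by blast
    \<comment> \<open>The inverse of \<open>F\<close>, which is \<open>F0\<close> followed by the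
      translation by \<open>k0\<close>.\<close>
    define G where "G x = H (x - k0)" for x
    have G_der: "(G has_derivative dF H (x - k0)) (at x)" for x
    proof -
      have "(H \<circ> (\<lambda>x. x - k0) has_derivative dF H (x - k0) \<circ> (\<lambda>v. v - 0)) (at x)"
        by (intro diff_chain_at has_derivative_diff has_derivative_ident has_derivative_const has_derivative_dF H_diff)
      then show ?thesis by (simp add: o_def G_def[abs_def])
    qed
    have close1: "norm (dF F1 x v - A *v v) \<le> eps * norm v" for x v
    proof -
      have "bounded_linear (\<lambda>v. dF F1 x v - A *v v)"
        using linear_dF[OF F1_diff] by (intro bounded_linear_sub matrix_vector_mul_bounded_linear) (simp add: linear_conv_bounded_linear)
      from onorm[OF this, of v] show ?thesis
        using mult_right_mono[OF less_imp_le[OF F1(4)[of x]] norm_ge_zero[of v]] by linarith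
    qed
    have close2: "norm (F1 x - F1 y - A *v (x - y)) \<le> eps * norm (x - y)" for x y
    proof -
      have "norm ((F1 x - A *v x) - (F1 y - A *v y)) \<le> eps * norm (x - y)"
      proof (rule differentiable_bound[of UNIV])
        show "((\<lambda>x. F1 x - A *v x) has_derivative (\<lambda>v. dF F1 x v - A *v v)) (at x within UNIV)" for x
          by (intro has_derivative_diff has_derivative_dF F1_diff bounded_linear_imp_has_derivative
                matrix_vector_mul_bounded_linear)
        show "onorm (\<lambda>v. dF F1 x v - A *v v) \<le> eps" for x using F1(4) less_imp_le by blast
      qed auto
      then show ?thesis by (simp add: algebra_simps)
    qed
    have F1_lat: "F1 (x + k) = F1 x + A *v k" if k: "k \<in> lat" for x k
    proof -
      have "tpi (F1 (x + k)) = tpi (F1 x)"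
        using F1(1) tpi_eq_iff[of "x + k" x] k by (simp add: is_lift_def)
      then have "F1 (x + k) - F1 x - A *v k \<in> lat"
        using tpi_eq_iff SL3Z_lat[OF assms(1) k] lat_diff by blast
      moreover have e: "F1 (x + k) - F1 x - A *v k = (F1 (x + k) - A *v (x + k)) - (F1 x - A *v x)"
        by (simp add: matrix_vector_right_distrib)
      \<comment> \<open>The difference of the displacements \<open>F1 - A\<close> at two points is
        below \<open>2 * eps < 1\<close>, so this integer vector is 0.\<close>
      have "norm (F1 (x + k) - F1 x - A *v k) < 1"
        unfolding e using norm_triangle_ineq4[of "F1 (x + k) - A *v (x + k)" "F1 x - A *v x"] F1(3)[of x] F1(3)[of "x + k"] eps(3)
        by linarith
      ultimately have "F1 (x + k) - F1 x - A *v k = 0" by (rule lat_small)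
      then show ?thesis by (simp add: algebra_simps)
    qed
    \<comment> \<open>The bound on the displacement contains \<open>norm k1\<close>, since
      \<open>F\<close> may be far from the lift that is close to \<open>A\<close>.\<close>
    interpret near_linear A a1 a2 a3 v3 l1 l2 l3 \<delta> c "c * (eps + norm k1)" F G N
    proof
      show "F (G x) = x" "G (F x) = x" for x by (simp_all add: G_def k0(2) F0H)
      show "F differentiable (at x)" "G differentiable (at x)" for x
        using F_der G_der differentiableI by blast+
      show "continuous_on UNIV (\<lambda>x. dF G x v)" for v
      proof -
        have "continuous_on UNIV (\<lambda>x. dF H x v)" using H unfolding C1_map_def by blast
        then have "continuous_on UNIV (\<lambda>x. dF H (x - k0) v)"
          by (rule continuous_on_compose2) (auto intro!: continuous_intros)
        then show ?thesis by (simp add: dF_eqI[OF G_der])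
      qed
      show "N (F x - F y - A *v (x - y)) \<le> \<delta> * N (x - y)" for x y
        using N_small[OF close2[of x y]] by (simp add: k1(2))
      show "N (dF F x v - A *v v) \<le> \<delta> * N v" for x v
        using N_small[OF close1[of x v]] by (simp add: dF_F)
      show "N (F x - A *v x) \<le> c * (eps + norm k1)" for x
      proof -
        have "norm (F x - A *v x) \<le> eps + norm k1"
          using norm_triangle_ineq[of "F1 x - A *v x" k1] F1(3)[of x] by (simp add: k1(2) algebra_simps)
        then have "c * norm (F x - A *v x) \<le> c * (eps + norm k1)" using c by (intro mult_left_mono) auto
        then show ?thesis using c2 order_trans by blast
      qed
      show "F (x + k) = F x + A *v k" if "k \<in> lat" for x k
        using F1_lat[OF that] by (simp add: k1(2))
      show "A *v k \<in> lat" "\<exists>j\<in>lat. A *v j = k" if "k \<in> lat" for k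
        using SL3Z_lat[OF assms(1) that] SL3Z_lat_surj[OF assms(1) that] by blast+
    qed (use a1 a2 a3 v3 c c1 c2 \<delta> assms(2) dense in \<open>auto simp: N_def\<close>)
    show ?thesis
      by (rule unstable_leaf_unbounded[OF ph acc]) (use line in \<open>auto simp: eigenline_def\<close>)
  qed
  show ?thesis
    by (rule exI[of _ eps], rule conjI[OF eps(1)]) (use main in blast)
qed

end
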